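(* Let $N\ge 1$ and let the elastic energy of a multi-curve-fold origami with $N$ creases be expressed as an integral along crease 1, with deformed arclength-parametrized space curve $\mathbf r_c:[0,S_0]\to\mathbb R^3$, curvature $\kappa>0$ and torsion $\tau$: $$E=\int_0^{S_0}\varepsilon\big(\kappa,\kappa',\dots,\kappa^{(2N)},\tau,\tau',\dots,\tau^{(2N-1)};S\big)\,dS ,$$ with $\varepsilon$ and $\mathbf r_c$ smooth. Put $$f=\sum_{i=0}^{2N}(-1)^i\frac{d^i}{dS^i}\,\partial_{\kappa^{(i)}}\varepsilon,\qquad g=\sum_{i=0}^{2N-1}(-1)^i\frac{d^i}{dS^i}\,\partial_{\tau^{(i)}}\varepsilon ,$$ evaluated along $\mathbf r_c$. Then the Euler-Lagrange equations of $E$ for systems with geometric constraints at the ends of the crease, i.e. the conditions in the interior of $[0,S_0]$ for $E$ to be stationary with respect to virtual displacements $\delta\mathbf r_c$ of the crease satisfying the inextensibility condition $\mathbf r_c'\cdot\delta\mathbf r_c'=0$ (and contributing no boundary terms), are $$f\kappa'+2\kappa f'+\Big(\frac{-f\tau^2-f\kappa^2+f''}{\kappa}\Big)'+g\tau'+2\tau g'+\Big(\frac{2\tau\big(\frac{g'}{\kappa}\big)'+\frac{g'}{\kappa}\tau'}{\kappa}\Big)'=0,$$ $$\frac{g'}{\kappa}\tau^2-(g\kappa)'-\Big(\frac{g'}{\kappa}\Big)''+f\tau'+2\tau f'=0 .$$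
   Context: A prime denotes $d/dS$, where $S$ is arclength along the crease. $\kappa$ and $\tau$ are the Frenet curvature and torsion, with Frenet equations $\mathbf t'=\kappa\mathbf n$, $\mathbf n'=-\kappa\mathbf t+\tau\mathbf b$, $\mathbf b'=-\tau\mathbf n$, $\mathbf t=\mathbf r_c'$. A virtual displacement is a smooth vector field $\delta\mathbf r_c$ along the crease; the first variation $\delta E$ is the linear part of the change of $E$ under $\mathbf r_c\mapsto\mathbf r_c+\delta\mathbf r_c$, and stationarity means $\delta E=0$. "Contributing no boundary terms" holds, for example, when $\delta\mathbf r_c$ vanishes near both ends $S=0$ and $S=S_0$. *)

theory Defs
  imports "HOL-Analysis.Analysis"
begin

section \<open>Differentiation of functions on an interval\<close>

text \<open>
  Derivatives are taken within the interval, so that they are one-sided at its end points and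
  depend only on the values of the function on the interval.
\<close>

definition D_on :: "real set \<Rightarrow> (real \<Rightarrow> 'a::real_normed_vector) \<Rightarrow> real \<Rightarrow> 'a"
  where "D_on I h s = vector_derivative h (at s within I)"

definition smooth_curve_on :: "real set \<Rightarrow> (real \<Rightarrow> 'a::real_normed_vector) \<Rightarrow> bool"
  where "smooth_curve_on I h \<longleftrightarrow> (\<forall>k. \<forall>s\<in>I. (D_on I ^^ k) h differentiable (at s within I))"


section \<open>Frenet data of a regular space curve\<close>

text \<open>
  The perturbed curve \<open>r + t \<eta>\<close> has unit speed only to first order in \<open>t\<close>.  The Frenet data are
  therefore defined for an arbitrary regular parametrization \<open>\<gamma>\<close>, with \<open>arc_D I \<gamma>\<close> the derivative
  with respect to the arclength of \<open>\<gamma>\<close>.  The torsion is read off from the Frenet equation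
  \<open>n' = - \<kappa> t + \<tau> b\<close>.
\<close>

definition speed :: "real set \<Rightarrow> (real \<Rightarrow> real^3) \<Rightarrow> real \<Rightarrow> real"
  where "speed I \<gamma> s = norm (D_on I \<gamma> s)"

definition arc_D :: "real set \<Rightarrow> (real \<Rightarrow> real^3) \<Rightarrow> (real \<Rightarrow> 'a::real_normed_vector) \<Rightarrow> real \<Rightarrow> 'a"
  where "arc_D I \<gamma> h s = D_on I h s /\<^sub>R speed I \<gamma> s"

definition tangent :: "real set \<Rightarrow> (real \<Rightarrow> real^3) \<Rightarrow> real \<Rightarrow> real^3"
  where "tangent I \<gamma> = arc_D I \<gamma> \<gamma>"

definition curvature :: "real set \<Rightarrow> (real \<Rightarrow> real^3) \<Rightarrow> real \<Rightarrow> real"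
  where "curvature I \<gamma> s = norm (arc_D I \<gamma> (tangent I \<gamma>) s)"

definition normal :: "real set \<Rightarrow> (real \<Rightarrow> real^3) \<Rightarrow> real \<Rightarrow> real^3"
  where "normal I \<gamma> s = arc_D I \<gamma> (tangent I \<gamma>) s /\<^sub>R curvature I \<gamma> s"

definition binormal :: "real set \<Rightarrow> (real \<Rightarrow> real^3) \<Rightarrow> real \<Rightarrow> real^3"
  where "binormal I \<gamma> s = cross3 (tangent I \<gamma> s) (normal I \<gamma> s)"

definition torsion :: "real set \<Rightarrow> (real \<Rightarrow> real^3) \<Rightarrow> real \<Rightarrow> real"
  where "torsion I \<gamma> s = arc_D I \<gamma> (normal I \<gamma>) s \<bullet> binormal I \<gamma> s"


section \<open>Energy densities\<close>

text \<open>
  The arguments of the density are labelled: \<open>Curv i\<close> is the slot of \<open>\<kappa>\<^sup>(\<^sup>i\<^sup>)\<close>, \<open>Tors j\<close> that of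
  \<open>\<tau>\<^sup>(\<^sup>j\<^sup>)\<close>, and \<open>Arclen\<close> that of the explicit argument \<open>S\<close>.  A density is a function of
  \<open>p :: jet_coord \<Rightarrow> real\<close> that depends only on the finitely many slots in \<open>jet_coords N\<close>.
\<close>

datatype jet_coord = Curv nat | Tors nat | Arclen

definition jet_coords :: "nat \<Rightarrow> jet_coord set"
  where "jet_coords N = Curv ` {..2 * N} \<union> Tors ` {..2 * N - 1} \<union> {Arclen}"

definition depends_only_on :: "jet_coord set \<Rightarrow> ((jet_coord \<Rightarrow> real) \<Rightarrow> real) \<Rightarrow> bool"
  where "depends_only_on V \<epsilon> \<longleftrightarrow> (\<forall>p q. (\<forall>v\<in>V. p v = q v) \<longrightarrow> \<epsilon> p = \<epsilon> q)"

definition partial :: "jet_coord \<Rightarrow> ((jet_coord \<Rightarrow> real) \<Rightarrow> real) \<Rightarrow> (jet_coord \<Rightarrow> real) \<Rightarrow> real"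
  where "partial v \<epsilon> p = deriv (\<lambda>x. \<epsilon> (p(v := x))) (p v)"

text \<open>
  All iterated partial derivatives exist and are continuous on \<open>U\<close>.  Openness and continuity refer
  to the product topology; for functions of finitely many slots this is the Euclidean notion.
\<close>

definition smooth_density_on :: "(jet_coord \<Rightarrow> real) set \<Rightarrow> ((jet_coord \<Rightarrow> real) \<Rightarrow> real) \<Rightarrow> bool"
  where "smooth_density_on U \<epsilon> \<longleftrightarrow> open U \<and>
    (\<forall>vs. continuous_on U (foldr partial vs \<epsilon>) \<and>
      (\<forall>p\<in>U. \<forall>v. (\<lambda>x. foldr partial vs \<epsilon> (p(v := x))) differentiable (at (p v))))"


section \<open>Energy and first variation\<close>

text \<open>
  The slot \<open>Arclen\<close> receives the parameter \<open>s\<close> itself, i.e. the material label of the crease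
  point, which is its arclength on the unit-speed crease.
\<close>

definition jet :: "real set \<Rightarrow> (real \<Rightarrow> real^3) \<Rightarrow> real \<Rightarrow> jet_coord \<Rightarrow> real"
  where "jet I \<gamma> s v =
    (case v of
       Curv i \<Rightarrow> (arc_D I \<gamma> ^^ i) (curvature I \<gamma>) s
     | Tors j \<Rightarrow> (arc_D I \<gamma> ^^ j) (torsion I \<gamma>) s
     | Arclen \<Rightarrow> s)"

definition energy :: "((jet_coord \<Rightarrow> real) \<Rightarrow> real) \<Rightarrow> real \<Rightarrow> (real \<Rightarrow> real^3) \<Rightarrow> real"
  where "energy \<epsilon> S0 \<gamma> =
    integral {0..S0} (\<lambda>s. \<epsilon> (jet {0..S0} \<gamma> s) * speed {0..S0} \<gamma> s)"

text \<open>
  Inextensible virtual displacements; vanishing near both ends ensures that no boundary terms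
  arise in the first variation.
\<close>

definition admissible :: "real \<Rightarrow> (real \<Rightarrow> real^3) \<Rightarrow> (real \<Rightarrow> real^3) \<Rightarrow> bool"
  where "admissible S0 r \<eta> \<longleftrightarrow>
    smooth_curve_on {0..S0} \<eta> \<and>
    (\<forall>s\<in>{0..S0}. D_on {0..S0} r s \<bullet> D_on {0..S0} \<eta> s = 0) \<and>
    (\<exists>\<delta>>0. \<forall>s\<in>{0..S0}. s < \<delta> \<or> S0 - \<delta> < s \<longrightarrow> \<eta> s = 0)"

definition stationary :: "((jet_coord \<Rightarrow> real) \<Rightarrow> real) \<Rightarrow> real \<Rightarrow> (real \<Rightarrow> real^3) \<Rightarrow> bool"
  where "stationary \<epsilon> S0 r \<longleftrightarrow>
    (\<forall>\<eta>. admissible S0 r \<eta> \<longrightarrow>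
      ((\<lambda>t. energy \<epsilon> S0 (\<lambda>s. r s + t *\<^sub>R \<eta> s)) has_real_derivative 0) (at 0))"


section \<open>The unit-speed case\<close>

lemma D_on_cong:
  assumes "\<And>x. x \<in> I \<Longrightarrow> g x = h x" "s \<in> I"
  shows "D_on I g s = D_on I h s"
proof -
  have "(g has_vector_derivative d) (at s within I) \<longleftrightarrow> (h has_vector_derivative d) (at s within I)" for d
    using assms by (metis has_vector_derivative_transform)
  then show ?thesis
    by (simp add: D_on_def vector_derivative_def)
qed

lemma arc_D_unit_speed:
  assumes unit: "\<And>x. x \<in> I \<Longrightarrow> speed I \<gamma> x = 1" and "s \<in> I"
  shows "(arc_D I \<gamma> ^^ k) h s = (D_on I ^^ k) h s"
  using \<open>s \<in> I\<close>
proof (induction k arbitrary: s)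
  case (Suc k)
  then have "D_on I ((arc_D I \<gamma> ^^ k) h) s = D_on I ((D_on I ^^ k) h) s"
    by (intro D_on_cong) auto
  with unit[OF Suc.prems] show ?case
    by (simp add: arc_D_def[of I \<gamma> "(arc_D I \<gamma> ^^ k) h" s])
qed simp

lemma energy_unit_speed:
  assumes unit: "\<And>s. s \<in> {0..S0} \<Longrightarrow> norm (D_on {0..S0} r s) = 1"
  shows "energy \<epsilon> S0 r = integral {0..S0} (\<lambda>s. \<epsilon> (\<lambda>v. case v of
      Curv i \<Rightarrow> (D_on {0..S0} ^^ i) (curvature {0..S0} r) s
    | Tors j \<Rightarrow> (D_on {0..S0} ^^ j) (torsion {0..S0} r) s
    | Arclen \<Rightarrow> s))"
  unfolding energy_def
proof (rule integral_cong)
  fix s assume s: "s \<in> {0..S0}"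
  have sp: "speed {0..S0} r x = 1" if "x \<in> {0..S0}" for x
    using unit[OF that] by (simp add: speed_def)
  have "jet {0..S0} r s = (\<lambda>v. case v of
      Curv i \<Rightarrow> (D_on {0..S0} ^^ i) (curvature {0..S0} r) s
    | Tors j \<Rightarrow> (D_on {0..S0} ^^ j) (torsion {0..S0} r) s
    | Arclen \<Rightarrow> s)"
    using arc_D_unit_speed[OF sp s]
    by (auto simp: jet_def fun_eq_iff split: jet_coord.split)
  with sp[OF s] show "\<epsilon> (jet {0..S0} r s) * speed {0..S0} r s = \<epsilon> (\<lambda>v. case v of
      Curv i \<Rightarrow> (D_on {0..S0} ^^ i) (curvature {0..S0} r) s
    | Tors j \<Rightarrow> (D_on {0..S0} ^^ j) (torsion {0..S0} r) s
    | Arclen \<Rightarrow> s)"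
    by simp
qed

end

(* To first order an inextensible displacement eta preserves arclength, so the variations of kappa
   and tau are n . eta'' and (b . eta''/kappa)' + kappa b . eta', and those of their derivatives
   follow by differentiating along the crease.  Integrating by parts turns the first variation into
   the integral of f (delta kappa) + g (delta tau), which equals Q' - P' . eta, where Q vanishes at
   the ends.  The vector P = mu t + w_n n + w_b b is the internal force; the multiplier mu is chosen
   such that P' has no normal component, and the t- and b-components of P' are, up to sign, the left
   hand sides of the two Euler-Lagrange equations.  Conversely eta = a t + (a'/kappa) n + q b is
   inextensible for arbitrary a and q; taking for a and q a bump function times the left hand sides
   makes the first variation minus the integral of the bump times a sum of squares. *)

theory Submission
  imports Defs
begin

section \<open>Smooth one-parameter families\<close>

text \<open>In general \<open>r + t \<eta>\<close> has unit speed only at \<open>t = 0\<close>, so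
  its curvature and torsion involve arclength derivatives whose normalisation itself varies with
  \<open>t\<close>. What saves the computation is that inextensibility makes the speed
  \<open>sqrt (1 + t^2 |\<eta>'|^2)\<close>, which is stationary at \<open>t = 0\<close>: variation
  commutes with arclength differentiation to every order, without correction terms. The analytic
  obstacle is that jets of arbitrary order must be differentiated in \<open>t\<close>, in
  \<open>s\<close> up to the ends of the interval, and under the integral; hence a calculus of
  families jointly smooth in \<open>t\<close> and \<open>s\<close> precedes the geometry.

  The freedom in the tangential force and the need to remove the normal component of its derivative
  both come from the constraint. Since \<open>t . \<eta>' = 0\<close>, any multiple of
  \<open>t\<close> may be added to the coefficient of \<open>\<eta>'\<close>. Differentiating
  \<open>t . \<eta>\<close> gives \<open>n . \<eta> = (t . \<eta>)' / \<kappa>\<close>, so the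
  normal component of \<open>\<eta>\<close> is not independent; only two free functions remain,
  hence two equations.\<close>

text \<open>
  A family \<open>F t s\<close> is differentiated in \<open>t\<close> at interior points and in \<open>s\<close> within \<open>I\<close>.  The partial
  derivatives are quantified existentially, so that closure under products, quotients, roots and
  composition is a plain induction on the order.
\<close>

primrec Ck_family ::
    "real set \<Rightarrow> real set \<Rightarrow> nat \<Rightarrow> (real \<Rightarrow> real \<Rightarrow> 'a::real_normed_vector) \<Rightarrow> bool"
  where
    "Ck_family T I 0 F \<longleftrightarrow> continuous_on (T \<times> I) (\<lambda>x. F (fst x) (snd x))"
  | "Ck_family T I (Suc k) F \<longleftrightarrow>
      continuous_on (T \<times> I) (\<lambda>x. F (fst x) (snd x)) \<and>
      (\<exists>Ft Fs. Ck_family T I k Ft \<and> Ck_family T I k Fs \<and>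
        (\<forall>t\<in>T. \<forall>s\<in>I. ((\<lambda>u. F u s) has_vector_derivative Ft t s) (at t) \<and>
          (F t has_vector_derivative Fs t s) (at s within I)))"

definition smooth_family ::
    "real set \<Rightarrow> real set \<Rightarrow> (real \<Rightarrow> real \<Rightarrow> 'a::real_normed_vector) \<Rightarrow> bool"
  where "smooth_family T I F \<longleftrightarrow> (\<forall>k. Ck_family T I k F)"

declare Ck_family.simps(2)[simp del]

lemma Ck_family_SucI:
  assumes "continuous_on (T \<times> I) (\<lambda>x. F (fst x) (snd x))"
    and "Ck_family T I k Ft" "Ck_family T I k Fs"
    and "\<And>t s. t \<in> T \<Longrightarrow> s \<in> I \<Longrightarrow> ((\<lambda>u. F u s) has_vector_derivative Ft t s) (at t)"
    and "\<And>t s. t \<in> T \<Longrightarrow> s \<in> I \<Longrightarrow> (F t has_vector_derivative Fs t s) (at s within I)"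
  shows "Ck_family T I (Suc k) F"
  using assms unfolding Ck_family.simps by blast

lemma Ck_family_SucE:
  assumes "Ck_family T I (Suc k) F"
  obtains Ft Fs where "Ck_family T I k Ft" "Ck_family T I k Fs"
    and "\<And>t s. t \<in> T \<Longrightarrow> s \<in> I \<Longrightarrow> ((\<lambda>u. F u s) has_vector_derivative Ft t s) (at t)"
    and "\<And>t s. t \<in> T \<Longrightarrow> s \<in> I \<Longrightarrow> (F t has_vector_derivative Fs t s) (at s within I)"
  using assms unfolding Ck_family.simps by blast

lemma Ck_family_continuous:
  "Ck_family T I k F \<Longrightarrow> continuous_on (T \<times> I) (\<lambda>x. F (fst x) (snd x))"
  by (cases k) (simp_all add: Ck_family.simps(2))

lemma Ck_family_Suc_imp: "Ck_family T I (Suc k) F \<Longrightarrow> Ck_family T I k F"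
proof (induction k arbitrary: F)
  case 0
  show ?case
    unfolding Ck_family.simps(1) by (rule Ck_family_continuous[OF 0])
next
  case (Suc k)
  from Suc.prems obtain Ft Fs where F: "Ck_family T I (Suc k) Ft" "Ck_family T I (Suc k) Fs"
    "\<And>t s. t \<in> T \<Longrightarrow> s \<in> I \<Longrightarrow> ((\<lambda>u. F u s) has_vector_derivative Ft t s) (at t)"
    "\<And>t s. t \<in> T \<Longrightarrow> s \<in> I \<Longrightarrow> (F t has_vector_derivative Fs t s) (at s within I)"
    by (erule Ck_family_SucE)
  show ?case
    by (rule Ck_family_SucI[OF Ck_family_continuous[OF Suc.prems] Suc.IH[OF F(1)] Suc.IH[OF F(2)] F(3,4)])
qed

lemma Ck_family_mono:
  assumes "Ck_family T I k F" "T' \<subseteq> T"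
  shows "Ck_family T' I k F"
  using assms
proof (induction k arbitrary: F)
  case 0
  then show ?case
    by (auto intro: continuous_on_subset)
next
  case (Suc k)
  have cont: "continuous_on (T' \<times> I) (\<lambda>x. F (fst x) (snd x))"
    by (rule continuous_on_subset[OF Ck_family_continuous[OF Suc.prems(1)]]) (use Suc.prems(2) in auto)
  from Suc.prems(1) obtain Ft Fs where F: "Ck_family T I k Ft" "Ck_family T I k Fs"
    "\<And>t s. t \<in> T \<Longrightarrow> s \<in> I \<Longrightarrow> ((\<lambda>u. F u s) has_vector_derivative Ft t s) (at t)"
    "\<And>t s. t \<in> T \<Longrightarrow> s \<in> I \<Longrightarrow> (F t has_vector_derivative Fs t s) (at s within I)"
    by (erule Ck_family_SucE)
  show ?case
    by (rule Ck_family_SucI[OF cont Suc.IH[OF F(1) Suc.prems(2)] Suc.IH[OF F(2) Suc.prems(2)]])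
      (use F(3,4) Suc.prems(2) in blast)+
qed

text \<open>Derivatives in \<open>t\<close> are two-sided, so agreement must hold on an open set of
  parameters; derivatives in \<open>s\<close> are taken within \<open>I\<close>, where agreement on
  \<open>I\<close> is enough.\<close>

lemma Ck_family_cong:
  assumes "Ck_family T I k F" "open T" "\<And>t s. t \<in> T \<Longrightarrow> s \<in> I \<Longrightarrow> G t s = F t s"
  shows "Ck_family T I k G"
proof -
  have cont: "continuous_on (T \<times> I) (\<lambda>x. G (fst x) (snd x))"
    using Ck_family_continuous[OF assms(1)] assms(3)
    by (subst continuous_on_cong[OF refl, where g = "\<lambda>x. F (fst x) (snd x)"]) auto
  show ?thesis
  proof (cases k)
    case (Suc j)
    from assms(1)[unfolded Suc] obtain Ft Fs where
      "Ck_family T I j Ft" and "Ck_family T I j Fs"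
      and t: "\<And>t s. t \<in> T \<Longrightarrow> s \<in> I \<Longrightarrow> ((\<lambda>u. F u s) has_vector_derivative Ft t s) (at t)"
      and s: "\<And>t s. t \<in> T \<Longrightarrow> s \<in> I \<Longrightarrow> (F t has_vector_derivative Fs t s) (at s within I)"
      by (erule Ck_family_SucE)
    moreover have "((\<lambda>u. G u s) has_vector_derivative Ft t s) (at t)" if "t \<in> T" "s \<in> I" for t s
      by (rule has_vector_derivative_transform_within_open[OF t[OF that] \<open>open T\<close>])
        (use that assms(3) in auto)
    moreover have "(G t has_vector_derivative Fs t s) (at s within I)" if "t \<in> T" "s \<in> I" for t s
      by (rule has_vector_derivative_transform[OF _ _ s[OF that]]) (use that assms(3) in auto)
    ultimately show ?thesis
      unfolding Suc by (intro Ck_family_SucI[OF cont])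
  qed (use cont in auto)
qed

lemma Ck_family_const: "Ck_family T I k (\<lambda>t s. c)"
proof (induction k arbitrary: c)
  case (Suc k)
  show ?case
    by (rule Ck_family_SucI[OF _ Suc[of 0] Suc[of 0]]) auto
qed auto

lemma Ck_family_parameter: "Ck_family T I k (\<lambda>t s. t)"
proof (cases k)
  case (Suc k)
  show ?thesis
    unfolding Suc
    by (rule Ck_family_SucI[OF _ Ck_family_const[of _ _ _ 1] Ck_family_const[of _ _ _ 0]])
      (auto intro!: continuous_on_fst continuous_on_snd continuous_on_id)
qed (auto intro!: continuous_on_fst continuous_on_snd continuous_on_id)

lemma Ck_family_position: "Ck_family T I k (\<lambda>t s. s)"
proof (cases k)
  case (Suc k)
  show ?thesis
    unfolding Suc
    by (rule Ck_family_SucI[OF _ Ck_family_const[of _ _ _ 0] Ck_family_const[of _ _ _ 1]])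
      (auto intro!: continuous_on_fst continuous_on_snd continuous_on_id)
qed (auto intro!: continuous_on_fst continuous_on_snd continuous_on_id)

lemma Ck_family_add:
  "Ck_family T I k F \<Longrightarrow> Ck_family T I k G \<Longrightarrow> Ck_family T I k (\<lambda>t s. F t s + G t s)"
proof (induction k arbitrary: F G)
  case (Suc k)
  from Suc.prems(1) obtain Ft Fs where F: "Ck_family T I k Ft" "Ck_family T I k Fs"
    "\<And>t s. t \<in> T \<Longrightarrow> s \<in> I \<Longrightarrow> ((\<lambda>u. F u s) has_vector_derivative Ft t s) (at t)"
    "\<And>t s. t \<in> T \<Longrightarrow> s \<in> I \<Longrightarrow> (F t has_vector_derivative Fs t s) (at s within I)"
    by (erule Ck_family_SucE)
  from Suc.prems(2) obtain Gt Gs where G: "Ck_family T I k Gt" "Ck_family T I k Gs"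
    "\<And>t s. t \<in> T \<Longrightarrow> s \<in> I \<Longrightarrow> ((\<lambda>u. G u s) has_vector_derivative Gt t s) (at t)"
    "\<And>t s. t \<in> T \<Longrightarrow> s \<in> I \<Longrightarrow> (G t has_vector_derivative Gs t s) (at s within I)"
    by (erule Ck_family_SucE)
  show ?case
    by (rule Ck_family_SucI[OF _ Suc.IH[OF F(1) G(1)] Suc.IH[OF F(2) G(2)]])
      (intro continuous_on_add Suc.prems[THEN Ck_family_continuous] has_vector_derivative_add F G; assumption)+
qed (auto intro!: continuous_intros)

lemma Ck_family_sum:
  assumes "finite A" "\<And>i. i \<in> A \<Longrightarrow> Ck_family T I k (F i)"
  shows "Ck_family T I k (\<lambda>t s. \<Sum>i\<in>A. F i t s)"
  using assms by (induction A) (auto intro: Ck_family_add Ck_family_const)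

text \<open>Products of numbers, scalings, inner products and cross products are all instances. The
  product rule keeps one factor undifferentiated, which is why both factors are also needed at the
  lower order.\<close>

lemma Ck_family_bilinear:
  assumes "bounded_bilinear B"
  shows "Ck_family T I k F \<Longrightarrow> Ck_family T I k G \<Longrightarrow> Ck_family T I k (\<lambda>t s. B (F t s) (G t s))"
proof (induction k arbitrary: F G)
  case (Suc k)
  from Suc.prems(1) obtain Ft Fs where F: "Ck_family T I k Ft" "Ck_family T I k Fs"
    "\<And>t s. t \<in> T \<Longrightarrow> s \<in> I \<Longrightarrow> ((\<lambda>u. F u s) has_vector_derivative Ft t s) (at t)"
    "\<And>t s. t \<in> T \<Longrightarrow> s \<in> I \<Longrightarrow> (F t has_vector_derivative Fs t s) (at s within I)"
    by (erule Ck_family_SucE)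
  from Suc.prems(2) obtain Gt Gs where G: "Ck_family T I k Gt" "Ck_family T I k Gs"
    "\<And>t s. t \<in> T \<Longrightarrow> s \<in> I \<Longrightarrow> ((\<lambda>u. G u s) has_vector_derivative Gt t s) (at t)"
    "\<And>t s. t \<in> T \<Longrightarrow> s \<in> I \<Longrightarrow> (G t has_vector_derivative Gs t s) (at s within I)"
    by (erule Ck_family_SucE)
  note FG = Suc.prems[THEN Ck_family_Suc_imp]
  show ?case
    by (rule Ck_family_SucI[OF _ Ck_family_add[OF Suc.IH[OF FG(1) G(1)] Suc.IH[OF F(1) FG(2)]]
          Ck_family_add[OF Suc.IH[OF FG(1) G(2)] Suc.IH[OF F(2) FG(2)]]])
      (auto intro!: bounded_bilinear.continuous_on[OF assms] Suc.prems[THEN Ck_family_continuous]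
        bounded_bilinear.has_vector_derivative[OF assms] F G)
qed (auto intro!: bounded_bilinear.continuous_on[OF assms])

text \<open>The derivative is a product containing the inverse itself, so the induction hypothesis
  applies to it once the order is lowered.\<close>

lemma Ck_family_inverse:
  fixes F :: "real \<Rightarrow> real \<Rightarrow> real"
  assumes "\<And>t s. t \<in> T \<Longrightarrow> s \<in> I \<Longrightarrow> F t s \<noteq> 0"
  shows "Ck_family T I k F \<Longrightarrow> Ck_family T I k (\<lambda>t s. inverse (F t s))"
proof (induction k)
  case (Suc k)
  from Suc.prems(1) obtain Ft Fs where F: "Ck_family T I k Ft" "Ck_family T I k Fs"
    "\<And>t s. t \<in> T \<Longrightarrow> s \<in> I \<Longrightarrow> ((\<lambda>u. F u s) has_vector_derivative Ft t s) (at t)"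
    "\<And>t s. t \<in> T \<Longrightarrow> s \<in> I \<Longrightarrow> (F t has_vector_derivative Fs t s) (at s within I)"
    by (erule Ck_family_SucE)
  note inv = Suc.IH[OF Ck_family_Suc_imp[OF Suc.prems]]
  have d: "Ck_family T I k (\<lambda>t s. (-1) * (inverse (F t s) * (H t s * inverse (F t s))))"
    if "Ck_family T I k H" for H :: "real \<Rightarrow> real \<Rightarrow> real"
    by (intro Ck_family_bilinear[OF bounded_bilinear_mult] Ck_family_const inv that)
  show ?case
    by (rule Ck_family_SucI[OF _ d[OF F(1)] d[OF F(2)]])
      (use F(3,4) assms in \<open>auto intro!: continuous_intros Suc.prems[THEN Ck_family_continuous]
        derivative_eq_intros simp flip: has_real_derivative_iff_has_vector_derivative\<close>)
qed (use assms in \<open>auto intro!: continuous_intros\<close>)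

text \<open>As for the inverse: the derivative \<open>F' / (2 sqrt F)\<close> contains the root
  itself at lower order.\<close>

lemma Ck_family_sqrt:
  fixes F :: "real \<Rightarrow> real \<Rightarrow> real"
  assumes "\<And>t s. t \<in> T \<Longrightarrow> s \<in> I \<Longrightarrow> F t s > 0"
  shows "Ck_family T I k F \<Longrightarrow> Ck_family T I k (\<lambda>t s. sqrt (F t s))"
proof (induction k)
  case (Suc k)
  from Suc.prems(1) obtain Ft Fs where F: "Ck_family T I k Ft" "Ck_family T I k Fs"
    "\<And>t s. t \<in> T \<Longrightarrow> s \<in> I \<Longrightarrow> ((\<lambda>u. F u s) has_vector_derivative Ft t s) (at t)"
    "\<And>t s. t \<in> T \<Longrightarrow> s \<in> I \<Longrightarrow> (F t has_vector_derivative Fs t s) (at s within I)"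
    by (erule Ck_family_SucE)
  note sq = Suc.IH[OF Ck_family_Suc_imp[OF Suc.prems]]
  have pos: "sqrt (F t s) \<noteq> 0" if "t \<in> T" "s \<in> I" for t s
    using assms[OF that] by simp
  have d: "Ck_family T I k (\<lambda>t s. (1/2) * (inverse (sqrt (F t s)) * H t s))"
    if "Ck_family T I k H" for H :: "real \<Rightarrow> real \<Rightarrow> real"
    by (intro Ck_family_bilinear[OF bounded_bilinear_mult] Ck_family_const
        Ck_family_inverse sq that pos)
  have chain: "((\<lambda>x. sqrt (y x)) has_real_derivative inverse (sqrt (y x)) * y' / 2) (at x within X)"
    if "(y has_real_derivative y') (at x within X)" "0 < y x" for y x y' X
    using DERIV_chain2[OF DERIV_real_sqrt[OF that(2)] that(1)] by simp
  show ?case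
    by (rule Ck_family_SucI[OF _ d[OF F(1)] d[OF F(2)]])
      (use F(3,4) in \<open>auto intro!: continuous_on_real_sqrt Suc.prems[THEN Ck_family_continuous] chain assms
        simp flip: has_real_derivative_iff_has_vector_derivative\<close>)
qed (auto intro!: continuous_on_real_sqrt)

lemma bounded_bilinear_cross3: "bounded_bilinear cross3"
  using bilinear_cross bilinear_conv_bounded_bilinear by blast

subsection \<open>Smooth densities along smooth families\<close>

lemma smooth_density_on_partial:
  assumes "smooth_density_on U \<epsilon>"
  shows "smooth_density_on U (partial v \<epsilon>)"
proof -
  have "foldr partial vs (partial v \<epsilon>) = foldr partial (vs @ [v]) \<epsilon>" for vs
    by simp
  then show ?thesis
    using assms unfolding smooth_density_on_def by metis
qed

lemma depends_only_on_partial: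
  assumes "depends_only_on V \<epsilon>"
  shows "depends_only_on V (partial v \<epsilon>)"
  unfolding depends_only_on_def
proof (intro allI impI)
  fix p q :: "jet_coord \<Rightarrow> real" assume pq: "\<forall>w\<in>V. p w = q w"
  show "partial v \<epsilon> p = partial v \<epsilon> q"
  proof (cases "v \<in> V")
    case True
    have "\<epsilon> (p(v := x)) = \<epsilon> (q(v := x))" for x
      using assms[unfolded depends_only_on_def, rule_format, of "p(v := x)" "q(v := x)"] pq by simp
    with True pq show ?thesis
      by (simp add: partial_def)
  next
    \<comment> \<open>A slot outside \<open>V\<close> does not influence \<open>\<epsilon>\<close>,
      so both partial derivatives are derivatives of constant functions.\<close>
    case False
    have "\<epsilon> (z(v := x)) = \<epsilon> z" for x z
      using assms[unfolded depends_only_on_def, rule_format, of "z(v := x)" z] False by fastforce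
    then show ?thesis
      by (simp add: partial_def)
  qed
qed

lemma smooth_density_on_imp_continuous:
  "smooth_density_on U \<epsilon> \<Longrightarrow> continuous_on U \<epsilon>"
proof -
  assume "smooth_density_on U \<epsilon>"
  then have "continuous_on U (foldr partial [] \<epsilon>)"
    unfolding smooth_density_on_def by blast
  then show "continuous_on U \<epsilon>" by simp
qed

lemma smooth_density_on_has_partial:
  assumes "smooth_density_on U \<epsilon>" "p(v := y) \<in> U"
  shows "((\<lambda>x. \<epsilon> (p(v := x))) has_real_derivative partial v \<epsilon> (p(v := y))) (at y)"
proof -
  have "(\<lambda>x. foldr partial [] \<epsilon> ((p(v := y))(v := x))) differentiable (at ((p(v := y)) v))"
    using assms unfolding smooth_density_on_def by blast
  then show ?thesis
    by (simp add: partial_def DERIV_deriv_iff_real_differentiable)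
qed

text \<open>Coordinates outside \<open>V\<close> stay at their values in \<open>p\<close>, so only
  the finitely many radii over \<open>V\<close> enter the minimum. Product-topology openness can
  then be used like Euclidean openness in the slots of \<open>V\<close>.\<close>

lemma open_fun_contains_box:
  fixes p :: "'i \<Rightarrow> real"
  assumes "open W" "p \<in> W" "finite V"
  obtains \<delta> where "\<delta> > 0"
    "\<And>q. (\<And>v. v \<in> V \<Longrightarrow> \<bar>q v - p v\<bar> < \<delta>) \<Longrightarrow> (\<And>v. v \<notin> V \<Longrightarrow> q v = p v) \<Longrightarrow> q \<in> W"
proof -
  obtain X where X: "p \<in> Pi\<^sub>E UNIV X" "\<And>i. open (X i)" "Pi\<^sub>E UNIV X \<subseteq> W"
    using product_topology_open_contains_basis[OF assms(1)[unfolded open_fun_def] assms(2)] by auto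
  have "\<exists>d>0. \<forall>y. \<bar>y - p v\<bar> < d \<longrightarrow> y \<in> X v" for v
    using X(1) X(2)[of v] by (auto simp: open_dist dist_real_def PiE_iff)
  then obtain d where d: "\<And>v. d v > 0" "\<And>v y. \<bar>y - p v\<bar> < d v \<Longrightarrow> y \<in> X v"
    by metis
  show ?thesis
  proof
    \<comment> \<open>The extra 1 keeps the minimum meaningful for empty \<open>V\<close>.\<close>
    show "Min (insert 1 (d ` V)) > 0"
      using assms(3) d(1) by auto
    fix q assume q: "\<And>v. v \<in> V \<Longrightarrow> \<bar>q v - p v\<bar> < Min (insert 1 (d ` V))" "\<And>v. v \<notin> V \<Longrightarrow> q v = p v"
    have "q v \<in> X v" for v
    proof (cases "v \<in> V")
      case True
      then show ?thesis
        using q(1)[OF True] assms(3) by (intro d(2)) auto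
    next
      case False
      then show ?thesis
        using q(2) X(1) by (auto simp: PiE_iff)
    qed
    then show "q \<in> W"
      using X(3) by (auto simp: PiE_iff)
  qed
qed

text \<open>Only partial derivatives are given, so the coordinates are switched on one at a time and the
  increment in each is estimated by the mean value theorem.\<close>

lemma density_chain_rule:
  fixes p :: "real \<Rightarrow> jet_coord \<Rightarrow> real"
  assumes \<epsilon>: "smooth_density_on U \<epsilon>" and V: "finite V" "depends_only_on V \<epsilon>"
    and pU: "p s \<in> U"
    and p': "\<And>v. v \<in> V \<Longrightarrow> ((\<lambda>x. p x v) has_real_derivative p' v) (at s within X)"
  shows "((\<lambda>x. \<epsilon> (p x)) has_real_derivative (\<Sum>v\<in>V. partial v \<epsilon> (p s) * p' v)) (at s within X)"
proof -
  define q where "q W x = (\<lambda>v. if v \<in> W then p x v else p s v)" for W x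
  have part: "((\<lambda>x. \<epsilon> (q W x)) has_real_derivative (\<Sum>v\<in>W. partial v \<epsilon> (p s) * p' v)) (at s within X)"
    if "finite W" "W \<subseteq> V" for W
    using that
  proof (induction W)
    case empty
    then show ?case by (simp add: q_def)
  next
    case (insert v W)
    define D where "D x = \<epsilon> ((q W x)(v := p x v)) - \<epsilon> ((q W x)(v := p s v))" for x
    \<comment> \<open>\<open>m\<close> is the difference quotient in slot \<open>v\<close>; the
      value chosen when the increment vanishes makes \<open>D x = m x * (p x v - p s v)\<close> hold
      without exception and is the expected limit.\<close>
    define m where "m x = (if p x v = p s v then partial v \<epsilon> (p s) else D x / (p x v - p s v))" for x
    have D_eq: "D x = m x * (p x v - p s v)" for x
      by (simp add: m_def D_def)
    have "(m \<longlongrightarrow> partial v \<epsilon> (p s)) (at s within X)"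
    proof (rule tendstoI)
      fix e :: real assume "e > 0"
      have "continuous_on U (partial v \<epsilon>)" "open U"
        using smooth_density_on_imp_continuous[OF smooth_density_on_partial[OF \<epsilon>]] \<epsilon>
        by (auto simp: smooth_density_on_def)
      then have "open (partial v \<epsilon> -` ball (partial v \<epsilon> (p s)) e \<inter> U)"
        by (simp add: continuous_on_open_vimage)
      then obtain \<delta> where "\<delta> > 0" and \<delta>: "\<And>z. (\<And>v. v \<in> V \<Longrightarrow> \<bar>z v - p s v\<bar> < \<delta>) \<Longrightarrow>
          (\<And>v. v \<notin> V \<Longrightarrow> z v = p s v) \<Longrightarrow> z \<in> partial v \<epsilon> -` ball (partial v \<epsilon> (p s)) e \<inter> U"
        using open_fun_contains_box[of _ "p s", OF _ _ V(1)] pU \<open>e > 0\<close>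
        by (metis (no_types, lifting) IntI centre_in_ball vimageI)
      have "\<forall>\<^sub>F x in at s within X. \<bar>p x w - p s w\<bar> < \<delta>" if "w \<in> V" for w
      proof -
        have "((\<lambda>x. p x w) \<longlongrightarrow> p s w) (at s within X)"
          using DERIV_isCont has_field_derivative_imp_has_derivative[OF p'[OF that]]
            has_derivative_continuous continuous_within by blast
        from tendstoD[OF this \<open>\<delta> > 0\<close>] show ?thesis
          by (simp add: dist_real_def)
      qed
      then have "\<forall>\<^sub>F x in at s within X. \<forall>w\<in>V. \<bar>p x w - p s w\<bar> < \<delta>"
        using V(1) by (auto intro: eventually_ball_finite)
      then show "\<forall>\<^sub>F x in at s within X. dist (m x) (partial v \<epsilon> (p s)) < e"
      proof (rule eventually_mono)
        fix x assume x: "\<forall>w\<in>V. \<bar>p x w - p s w\<bar> < \<delta>"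
        \<comment> \<open>Every point between the two values of slot \<open>v\<close> stays in the
          box around \<open>p s\<close>, so the mean value theorem applies and its intermediate
          point has a partial derivative close to the one at \<open>p s\<close>.\<close>
        have inU: "(q W x)(v := y) \<in> partial v \<epsilon> -` ball (partial v \<epsilon> (p s)) e \<inter> U"
          if "\<bar>y - p s v\<bar> \<le> \<bar>p x v - p s v\<bar>" for y
        proof (rule \<delta>)
          fix w assume "w \<in> V"
          show "\<bar>((q W x)(v := y)) w - p s w\<bar> < \<delta>"
            using x \<open>w \<in> V\<close> that \<open>\<delta> > 0\<close> by (auto simp: q_def intro: le_less_trans)
        qed (use insert.prems in \<open>auto simp: q_def\<close>)
        have der: "((\<lambda>y. \<epsilon> ((q W x)(v := y))) has_real_derivative partial v \<epsilon> ((q W x)(v := y))) (at y)"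
          if "\<bar>y - p s v\<bar> \<le> \<bar>p x v - p s v\<bar>" for y
          using smooth_density_on_has_partial[OF \<epsilon>] inU[OF that] by blast
        have "\<exists>y. \<bar>y - p s v\<bar> \<le> \<bar>p x v - p s v\<bar> \<and> D x = (p x v - p s v) * partial v \<epsilon> ((q W x)(v := y))"
          if "p x v \<noteq> p s v"
        proof (cases "p s v < p x v")
          case True
          show ?thesis
            using MVT2[OF True, of "\<lambda>y. \<epsilon> ((q W x)(v := y))" "\<lambda>y. partial v \<epsilon> ((q W x)(v := y))"] der True
            by (force simp: D_def)
        next
          case False
          with that have lt: "p x v < p s v" by simp
          obtain z where z: "p x v < z" "z < p s v" "\<epsilon> ((q W x)(v := p s v)) - \<epsilon> ((q W x)(v := p x v))
              = (p s v - p x v) * partial v \<epsilon> ((q W x)(v := z))"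
            using MVT2[OF lt, of "\<lambda>y. \<epsilon> ((q W x)(v := y))" "\<lambda>y. partial v \<epsilon> ((q W x)(v := y))"] der lt
            by force
          then show ?thesis
            by (intro exI[of _ z]) (auto simp: D_def algebra_simps)
        qed
        then show "dist (m x) (partial v \<epsilon> (p s)) < e"
          using inU \<open>e > 0\<close> by (fastforce simp: m_def dist_commute)
      qed
    qed
    then have "((\<lambda>x. m x * ((p x v - p s v) / (x - s))) \<longlongrightarrow> partial v \<epsilon> (p s) * p' v) (at s within X)"
      using p'[of v] insert.prems by (intro tendsto_mult) (auto simp: has_field_derivative_iff)
    then have "(D has_real_derivative partial v \<epsilon> (p s) * p' v) (at s within X)"
      by (simp add: has_field_derivative_iff D_eq)
    then have "((\<lambda>x. \<epsilon> (q W x) + D x) has_real_derivative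
        (\<Sum>v\<in>W. partial v \<epsilon> (p s) * p' v) + partial v \<epsilon> (p s) * p' v) (at s within X)"
      using insert by (intro derivative_intros) auto
    moreover have "\<epsilon> (q W x) + D x = \<epsilon> (q (insert v W) x)" for x
    proof -
      have "(q W x)(v := p s v) = q W x" "(q W x)(v := p x v) = q (insert v W) x"
        using insert.hyps by (auto simp: q_def)
      then show ?thesis
        by (simp add: D_def)
    qed
    ultimately show ?case
      using insert by (simp add: add.commute)
  qed
  \<comment> \<open>With all of \<open>V\<close> switched on, \<open>q V x\<close> and
    \<open>p x\<close> can differ only in slots that \<open>\<epsilon>\<close> ignores.\<close>
  have "\<epsilon> (q V x) = \<epsilon> (p x)" for x
    using V(2)[unfolded depends_only_on_def, rule_format, of "q V x" "p x"] by (simp add: q_def)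
  with part[OF V(1) order_refl] show ?thesis
    by simp
qed

text \<open>By the chain rule the derivatives are sums of partials of \<open>\<epsilon>\<close>,
  composed with the same family, times derivatives of the slots. Partials are again smooth densities
  in the slots \<open>V\<close>, so the induction runs over all densities at once.\<close>

lemma Ck_family_density:
  assumes "finite V"
    and "\<And>t s. t \<in> T \<Longrightarrow> s \<in> I \<Longrightarrow> (\<lambda>v. F v t s) \<in> U"
  shows "smooth_density_on U \<epsilon> \<Longrightarrow> depends_only_on V \<epsilon> \<Longrightarrow> (\<And>v. Ck_family T I k (F v)) \<Longrightarrow>
    Ck_family T I k (\<lambda>t s. \<epsilon> (\<lambda>v. F v t s))"
proof (induction k arbitrary: \<epsilon>)
  have sub: "(\<lambda>x v. F v (fst x) (snd x)) ` (T \<times> I) \<subseteq> U"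
    using assms(2) by auto
  {
    case 0
    have "continuous_on (T \<times> I) (\<lambda>x v. F v (fst x) (snd x))"
      using 0 by (intro continuous_on_coordinatewise_then_product) auto
    from continuous_on_compose2[OF smooth_density_on_imp_continuous[OF 0(1)] this sub]
    show ?case by simp
  next
    case (Suc k)
    \<comment> \<open>The two derivatives are paired so that one application of choice selects them
      for all slots simultaneously.\<close>
    have "\<forall>v. \<exists>z. Ck_family T I k (fst z) \<and> Ck_family T I k (snd z) \<and>
        (\<forall>t\<in>T. \<forall>s\<in>I. ((\<lambda>u. F v u s) has_vector_derivative fst z t s) (at t) \<and>
          (F v t has_vector_derivative snd z t s) (at s within I))"
      using Suc.prems(3) unfolding Ck_family.simps by simp
    from choice[OF this] obtain z where z: "\<forall>v. Ck_family T I k (fst (z v)) \<and>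
        Ck_family T I k (snd (z v)) \<and>
        (\<forall>t\<in>T. \<forall>s\<in>I. ((\<lambda>u. F v u s) has_vector_derivative fst (z v) t s) (at t) \<and>
          (F v t has_vector_derivative snd (z v) t s) (at s within I))" ..
    define Ft Fs where "Ft v = fst (z v)" and "Fs v = snd (z v)" for v
    have F: "\<And>v. Ck_family T I k (Ft v)" "\<And>v. Ck_family T I k (Fs v)"
      "\<And>v t s. t \<in> T \<Longrightarrow> s \<in> I \<Longrightarrow> ((\<lambda>u. F v u s) has_vector_derivative Ft v t s) (at t)"
      "\<And>v t s. t \<in> T \<Longrightarrow> s \<in> I \<Longrightarrow> (F v t has_vector_derivative Fs v t s) (at s within I)"
      using z unfolding Ft_def Fs_def by simp_all
    note smooth = smooth_density_on_partial[OF Suc.prems(1)] depends_only_on_partial[OF Suc.prems(2)]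
      Ck_family_Suc_imp[OF Suc.prems(3)]
    have d: "Ck_family T I k (\<lambda>t s. \<Sum>v\<in>V. partial v \<epsilon> (\<lambda>w. F w t s) * G v t s)"
      if "\<And>v. Ck_family T I k (G v)" for G
      by (rule Ck_family_sum[OF assms(1)],
          rule Ck_family_bilinear[OF bounded_bilinear_mult Suc.IH[OF smooth] that])
    have "continuous_on (T \<times> I) (\<lambda>x v. F v (fst x) (snd x))"
      using Suc.prems(3)[THEN Ck_family_continuous]
      by (intro continuous_on_coordinatewise_then_product) auto
    from continuous_on_compose2[OF smooth_density_on_imp_continuous[OF Suc.prems(1)] this sub]
    have "continuous_on (T \<times> I) (\<lambda>x. \<epsilon> (\<lambda>v. F v (fst x) (snd x)))" .
    then show ?case
    proof (rule Ck_family_SucI[OF _ d[OF F(1)] d[OF F(2)]])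
      fix t s assume ts: "t \<in> T" "s \<in> I"
      note chain = density_chain_rule[OF Suc.prems(1) assms(1) Suc.prems(2)]
      note F' = F(3,4)[OF ts, folded has_real_derivative_iff_has_vector_derivative]
      show "((\<lambda>u. \<epsilon> (\<lambda>v. F v u s)) has_vector_derivative
          (\<Sum>v\<in>V. partial v \<epsilon> (\<lambda>w. F w t s) * Ft v t s)) (at t)"
        unfolding has_real_derivative_iff_has_vector_derivative[symmetric]
        by (rule chain[of "\<lambda>u v. F v u s"]) (rule assms(2)[OF ts], rule F')
      show "((\<lambda>u. \<epsilon> (\<lambda>v. F v t u)) has_vector_derivative
          (\<Sum>v\<in>V. partial v \<epsilon> (\<lambda>w. F w t s) * Fs v t s)) (at s within I)"
        unfolding has_real_derivative_iff_has_vector_derivative[symmetric]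
        by (rule chain[of "\<lambda>u v. F v t u"]) (rule assms(2)[OF ts], rule F')
    qed
  }
qed

section \<open>Closure properties of smooth families\<close>

named_theorems smooth_intros

lemma smooth_family_const [smooth_intros]: "smooth_family T I (\<lambda>t s. c)"
  by (simp add: smooth_family_def Ck_family_const)

lemma smooth_family_parameter [smooth_intros]: "smooth_family T I (\<lambda>t s. t)"
  by (simp add: smooth_family_def Ck_family_parameter)

lemma smooth_family_position [smooth_intros]: "smooth_family T I (\<lambda>t s. s)"
  by (simp add: smooth_family_def Ck_family_position)

lemma smooth_family_add [smooth_intros]:
  "smooth_family T I F \<Longrightarrow> smooth_family T I G \<Longrightarrow> smooth_family T I (\<lambda>t s. F t s + G t s)"
  by (simp add: smooth_family_def Ck_family_add)

lemma smooth_family_sum [smooth_intros]: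
  "finite A \<Longrightarrow> (\<And>i. i \<in> A \<Longrightarrow> smooth_family T I (F i)) \<Longrightarrow> smooth_family T I (\<lambda>t s. \<Sum>i\<in>A. F i t s)"
  by (simp add: smooth_family_def Ck_family_sum)

lemma smooth_family_bilinear:
  "bounded_bilinear B \<Longrightarrow> smooth_family T I F \<Longrightarrow> smooth_family T I G \<Longrightarrow>
    smooth_family T I (\<lambda>t s. B (F t s) (G t s))"
  by (simp add: smooth_family_def Ck_family_bilinear)

lemmas smooth_family_mult [smooth_intros] = smooth_family_bilinear[OF bounded_bilinear_mult]
lemmas smooth_family_scaleR [smooth_intros] = smooth_family_bilinear[OF bounded_bilinear_scaleR]
lemmas smooth_family_inner [smooth_intros] = smooth_family_bilinear[OF bounded_bilinear_inner]
lemmas smooth_family_cross3 [smooth_intros] = smooth_family_bilinear[OF bounded_bilinear_cross3]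

lemma smooth_family_minus [smooth_intros]:
  assumes "smooth_family T I F"
  shows "smooth_family T I (\<lambda>t s. - F t s)"
  using smooth_family_scaleR[OF smooth_family_const[of _ _ "-1"] assms] by simp

lemma smooth_family_diff [smooth_intros]:
  assumes "smooth_family T I F" "smooth_family T I G"
  shows "smooth_family T I (\<lambda>t s. F t s - G t s)"
  using smooth_family_add[OF assms(1) smooth_family_minus[OF assms(2)]] by simp

lemma smooth_family_power2 [smooth_intros]:
  fixes F :: "real \<Rightarrow> real \<Rightarrow> real"
  shows "smooth_family T I F \<Longrightarrow> smooth_family T I (\<lambda>t s. (F t s)\<^sup>2)"
  unfolding power2_eq_square by (intro smooth_intros)

lemma smooth_family_inverse [smooth_intros]:
  fixes F :: "real \<Rightarrow> real \<Rightarrow> real"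
  shows "smooth_family T I F \<Longrightarrow> (\<And>t s. t \<in> T \<Longrightarrow> s \<in> I \<Longrightarrow> F t s \<noteq> 0) \<Longrightarrow>
    smooth_family T I (\<lambda>t s. inverse (F t s))"
  by (simp add: smooth_family_def Ck_family_inverse)

lemma smooth_family_divide [smooth_intros]:
  fixes F G :: "real \<Rightarrow> real \<Rightarrow> real"
  shows "smooth_family T I F \<Longrightarrow> smooth_family T I G \<Longrightarrow> (\<And>t s. t \<in> T \<Longrightarrow> s \<in> I \<Longrightarrow> G t s \<noteq> 0) \<Longrightarrow>
    smooth_family T I (\<lambda>t s. F t s / G t s)"
  unfolding divide_inverse by (intro smooth_intros)

lemma smooth_family_norm:
  fixes F :: "real \<Rightarrow> real \<Rightarrow> 'a::real_inner"
  assumes "smooth_family T I F" "\<And>t s. t \<in> T \<Longrightarrow> s \<in> I \<Longrightarrow> F t s \<noteq> 0"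
  shows "smooth_family T I (\<lambda>t s. norm (F t s))"
proof -
  have "smooth_family T I (\<lambda>t s. F t s \<bullet> F t s)"
    by (intro smooth_intros assms)
  then show ?thesis
    unfolding norm_eq_sqrt_inner smooth_family_def
    by (auto intro!: Ck_family_sqrt simp: assms)
qed

lemma smooth_family_density:
  assumes "smooth_density_on U \<epsilon>" "finite V" "depends_only_on V \<epsilon>"
    and "\<And>v. smooth_family T I (F v)" "\<And>t s. t \<in> T \<Longrightarrow> s \<in> I \<Longrightarrow> (\<lambda>v. F v t s) \<in> U"
  shows "smooth_family T I (\<lambda>t s. \<epsilon> (\<lambda>v. F v t s))"
  unfolding smooth_family_def
proof
  fix k show "Ck_family T I k (\<lambda>t s. \<epsilon> (\<lambda>v. F v t s))"
    by (rule Ck_family_density[OF assms(2) assms(5) assms(1) assms(3)])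
      (use assms(4) in \<open>auto simp: smooth_family_def\<close>)
qed

lemma smooth_family_mono: "smooth_family T I F \<Longrightarrow> T' \<subseteq> T \<Longrightarrow> smooth_family T' I F"
  unfolding smooth_family_def using Ck_family_mono by blast

lemma smooth_family_continuous:
  "smooth_family T I F \<Longrightarrow> continuous_on (T \<times> I) (\<lambda>x. F (fst x) (snd x))"
  unfolding smooth_family_def using Ck_family_continuous by blast

lemma smooth_family_imp_continuous_on:
  assumes "smooth_family T I F" "t \<in> T"
  shows "continuous_on I (F t)"
proof -
  have "continuous_on I (\<lambda>s. F (fst (t, s)) (snd (t, s)))"
    by (rule continuous_on_compose2[OF smooth_family_continuous[OF assms(1)]])
      (use assms(2) in \<open>auto intro: continuous_on_Pair continuous_on_const continuous_on_id\<close>)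
  then show ?thesis by simp
qed

text \<open>Smooth functions of \<open>s\<close> alone are encoded as families constant in the
  parameter. Freezing \<open>t\<close> gives such a family over any \<open>T'\<close>, with zero as
  its parameter derivative.\<close>

lemma smooth_family_slice:
  assumes "smooth_family T I F" "t \<in> T"
  shows "smooth_family T' I (\<lambda>_. F t)"
proof -
  have cont: "continuous_on (T' \<times> I) (\<lambda>x. F t (snd x))" if "Ck_family T I k F" for F :: "real \<Rightarrow> real \<Rightarrow> 'a" and k
  proof -
    have "continuous_on (T' \<times> I) (\<lambda>x. F (fst (t, snd x)) (snd (t, snd x)))"
      by (rule continuous_on_compose2[OF Ck_family_continuous[OF that]])
        (use assms(2) in \<open>auto intro!: continuous_on_Pair continuous_on_const continuous_on_snd continuous_on_id\<close>)
    then show ?thesis by simp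
  qed
  have "Ck_family T' I k (\<lambda>_. F t)" if "Ck_family T I k F" for k
    using that
  proof (induction k arbitrary: F)
    case 0
    then show ?case
      using cont[of 0] by simp
  next
    case (Suc k)
    from Suc.prems obtain Ft Fs where F: "Ck_family T I k Ft" "Ck_family T I k Fs"
      "\<And>t s. t \<in> T \<Longrightarrow> s \<in> I \<Longrightarrow> ((\<lambda>u. F u s) has_vector_derivative Ft t s) (at t)"
      "\<And>t s. t \<in> T \<Longrightarrow> s \<in> I \<Longrightarrow> (F t has_vector_derivative Fs t s) (at s within I)"
      by (erule Ck_family_SucE)
    show ?case
      by (rule Ck_family_SucI[OF cont[OF Suc.prems] Ck_family_const[of _ _ _ 0] Suc.IH[OF F(2)]])
        (simp, rule F(4)[OF \<open>t \<in> T\<close>])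
  qed
  with assms(1) show ?thesis
    by (simp add: smooth_family_def)
qed

subsection \<open>Derivatives of smooth families\<close>

definition parameter_D :: "(real \<Rightarrow> real \<Rightarrow> 'a::real_normed_vector) \<Rightarrow> real \<Rightarrow> real \<Rightarrow> 'a"
  where "parameter_D F t s = vector_derivative (\<lambda>u. F u s) (at t)"

lemma D_on_eq:
  assumes "(h has_vector_derivative h') (at s within {0..S0})" "0 < S0" "s \<in> {0..S0}"
  shows "D_on {0..S0} h s = h'"
  using vector_derivative_within_cbox[OF assms(2), of s h h'] assms by (simp add: D_on_def)

lemma parameter_D_eq:
  "((\<lambda>u. F u s) has_vector_derivative F') (at t) \<Longrightarrow> parameter_D F t s = F'"
  by (simp add: parameter_D_def vector_derivative_at)

lemma smooth_family_Ck_family_SucE: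
  assumes "smooth_family T I F"
  obtains Ft Fs where "Ck_family T I k Ft" "Ck_family T I k Fs"
    "\<And>t s. t \<in> T \<Longrightarrow> s \<in> I \<Longrightarrow> ((\<lambda>u. F u s) has_vector_derivative Ft t s) (at t)"
    "\<And>t s. t \<in> T \<Longrightarrow> s \<in> I \<Longrightarrow> (F t has_vector_derivative Fs t s) (at s within I)"
proof -
  from assms have "Ck_family T I (Suc k) F"
    by (simp add: smooth_family_def)
  then show ?thesis
    by (rule Ck_family_SucE) (rule that)
qed

lemma smooth_family_has_D_on:
  assumes "smooth_family T {0..S0} F" "0 < S0" "t \<in> T" "s \<in> {0..S0}"
  shows "(F t has_vector_derivative D_on {0..S0} (F t) s) (at s within {0..S0})"
proof -
  obtain Ft Fs where "(F t has_vector_derivative Fs t s) (at s within {0..S0})"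
    by (rule smooth_family_Ck_family_SucE[OF assms(1), of 0]) (use assms(3,4) in blast)
  with D_on_eq[OF this assms(2,4)] show ?thesis
    by simp
qed

lemma smooth_family_has_parameter_D:
  assumes "smooth_family T I F" "t \<in> T" "s \<in> I"
  shows "((\<lambda>u. F u s) has_vector_derivative parameter_D F t s) (at t)"
proof -
  obtain Ft Fs where "((\<lambda>u. F u s) has_vector_derivative Ft t s) (at t)"
    by (rule smooth_family_Ck_family_SucE[OF assms(1), of 0]) (use assms(2,3) in blast)
  with parameter_D_eq[of F, OF this] show ?thesis
    by simp
qed

text \<open>The witnesses for the derivative in \<open>Ck_family\<close> may change with the order.
  Uniqueness of derivatives identifies each of them on \<open>T \<times> {0..S0}\<close> with the
  one function \<open>D_on\<close>, which therefore has every order.\<close>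

lemma smooth_family_D_on [smooth_intros]:
  assumes "smooth_family T {0..S0} F" "0 < S0" "open T"
  shows "smooth_family T {0..S0} (\<lambda>t. D_on {0..S0} (F t))"
  unfolding smooth_family_def
proof
  fix k
  obtain Ft Fs where F: "Ck_family T {0..S0} k Fs"
    "\<And>t s. t \<in> T \<Longrightarrow> s \<in> {0..S0} \<Longrightarrow> (F t has_vector_derivative Fs t s) (at s within {0..S0})"
    by (rule smooth_family_Ck_family_SucE[OF assms(1), of k]) blast
  show "Ck_family T {0..S0} k (\<lambda>t. D_on {0..S0} (F t))"
    by (rule Ck_family_cong[OF F(1) assms(3)]) (rule D_on_eq[OF F(2) assms(2)])
qed

lemma smooth_family_parameter_D [smooth_intros]:
  assumes "smooth_family T I F" "open T"
  shows "smooth_family T I (parameter_D F)"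
  unfolding smooth_family_def
proof
  fix k
  obtain Ft Fs where F: "Ck_family T I k Ft"
    "\<And>t s. t \<in> T \<Longrightarrow> s \<in> I \<Longrightarrow> ((\<lambda>u. F u s) has_vector_derivative Ft t s) (at t)"
    by (rule smooth_family_Ck_family_SucE[OF assms(1), of k]) blast
  show "Ck_family T I k (parameter_D F)"
    by (rule Ck_family_cong[OF F(1) assms(2)]) (rule parameter_D_eq[OF F(2)])
qed

lemma leibniz_smooth_family:
  fixes F :: "real \<Rightarrow> real \<Rightarrow> 'a::banach"
  assumes F: "smooth_family T {0..S0} F" and T: "open T" "t \<in> T" and s: "s \<in> {0..S0}"
  shows "((\<lambda>u. integral {0..s} (F u)) has_vector_derivative integral {0..s} (parameter_D F t)) (at t)"
proof -
  \<comment> \<open>Differentiation under the integral sign is available over convex parameter sets,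
    so \<open>T\<close> is replaced by a ball.\<close>
  obtain e where e: "e > 0" "ball t e \<subseteq> T"
    using T open_contains_ball by blast
  have sub: "ball t e \<times> cbox 0 s \<subseteq> T \<times> {0..S0}"
    using e s by auto
  have "((\<lambda>u. integral (cbox 0 s) (F u)) has_vector_derivative integral (cbox 0 s) (parameter_D F t))
      (at t within ball t e)"
  proof (rule leibniz_rule_vector_derivative)
    show "((\<lambda>x. F x u) has_vector_derivative parameter_D F x u) (at x within ball t e)"
      if "x \<in> ball t e" "u \<in> cbox 0 s" for x u
      by (rule has_vector_derivative_at_within[OF smooth_family_has_parameter_D[OF F]])
        (use that e(2) s in \<open>auto simp: subset_iff\<close>)
    show "F x integrable_on cbox 0 s" if "x \<in> ball t e" for x
      by (rule integrable_continuous, rule continuous_on_subset[OF smooth_family_imp_continuous_on[OF F]])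
        (use that e(2) s in \<open>auto simp: subset_iff\<close>)
    show "continuous_on (ball t e \<times> cbox 0 s) (\<lambda>(x, y). parameter_D F x y)"
      using continuous_on_subset[OF smooth_family_continuous[OF smooth_family_parameter_D[OF F T(1)]] sub]
      by (simp add: case_prod_beta)
  qed (use e in auto)
  then show ?thesis
    using e(1) by (simp add: at_within_open[of t "ball t e"])
qed

text \<open>The mixed partial derivatives commute: differentiate
  \<open>F t x = F t 0 + \<integral>\<^sub>0\<^sup>x \<partial>\<^sub>sF t\<close> in \<open>t\<close> under the integral sign, then in \<open>x\<close>.\<close>

lemma D_on_parameter_D:
  fixes F :: "real \<Rightarrow> real \<Rightarrow> 'a::banach"
  assumes F: "smooth_family T {0..S0} F" and S0: "0 < S0" and T: "open T" "t \<in> T"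
    and s: "s \<in> {0..S0}"
  shows "parameter_D (\<lambda>t. D_on {0..S0} (F t)) t s = D_on {0..S0} (parameter_D F t) s"
proof -
  let ?G = "\<lambda>t. D_on {0..S0} (F t)"
  note G = smooth_family_D_on[OF F S0 T(1)]
  have "parameter_D F t x = parameter_D F t 0 + integral {0..x} (parameter_D ?G t)"
    if x: "x \<in> {0..S0}" for x
  proof (rule parameter_D_eq)
    have FTC: "F u 0 + integral {0..x} (?G u) = F u x" if "u \<in> T" for u
    proof -
      have "(?G u has_integral F u x - F u 0) {0..x}"
        by (rule fundamental_theorem_of_calculus)
          (use x smooth_family_has_D_on[OF F S0 \<open>u \<in> T\<close>] in
            \<open>auto intro!: has_vector_derivative_within_subset[where T = "{0..x}" and S = "{0..S0}"]\<close>)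
      then show ?thesis
        by (simp add: integral_unique)
    qed
    have "((\<lambda>u. F u 0 + integral {0..x} (?G u)) has_vector_derivative
        parameter_D F t 0 + integral {0..x} (parameter_D ?G t)) (at t)"
      using x S0 smooth_family_has_parameter_D[OF F T(2), of 0] leibniz_smooth_family[OF G T x]
      by (intro has_vector_derivative_add) auto
    then show "((\<lambda>u. F u x) has_vector_derivative
        parameter_D F t 0 + integral {0..x} (parameter_D ?G t)) (at t)"
      by (rule has_vector_derivative_transform_within_open[OF _ T FTC])
  qed
  then have "D_on {0..S0} (parameter_D F t) s =
      D_on {0..S0} (\<lambda>x. parameter_D F t 0 + integral {0..x} (parameter_D ?G t)) s"
    by (rule D_on_cong[OF _ s])
  also have "\<dots> = parameter_D ?G t s"
  proof (rule D_on_eq[OF _ S0 s])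
    have "continuous_on {0..S0} (parameter_D ?G t)"
      by (rule smooth_family_imp_continuous_on[OF smooth_family_parameter_D[OF G T(1)] T(2)])
    from has_vector_derivative_add[OF has_vector_derivative_const integral_has_vector_derivative[OF this s]]
    show "((\<lambda>x. parameter_D F t 0 + integral {0..x} (parameter_D ?G t)) has_vector_derivative
        parameter_D ?G t s) (at s within {0..S0})"
      by simp
  qed
  finally show ?thesis ..
qed

text \<open>Each iterated derivative is differentiable, hence continuous, and serves as witness for
  the next order; the converse is closure under \<open>D_on\<close>. This carries the smoothness
  notion of the statement into the calculus of families and back.\<close>

lemma smooth_curve_on_iff:
  assumes "0 < S0"
  shows "smooth_curve_on {0..S0} h \<longleftrightarrow> smooth_family UNIV {0..S0} (\<lambda>_. h)"
proof
  assume h: "smooth_curve_on {0..S0} h"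
  have der: "((D_on {0..S0} ^^ j) h has_vector_derivative (D_on {0..S0} ^^ Suc j) h s) (at s within {0..S0})"
    if "s \<in> {0..S0}" for s j
    using h that unfolding smooth_curve_on_def by (simp add: D_on_def vector_derivative_works)
  have cont: "continuous_on (UNIV \<times> {0..S0}) (\<lambda>x. (D_on {0..S0} ^^ j) h (snd x))" for j
  proof (rule continuous_on_compose2[of "{0..S0}" "(D_on {0..S0} ^^ j) h"])
    show "continuous_on {0..S0} ((D_on {0..S0} ^^ j) h)"
      using der has_vector_derivative_continuous unfolding continuous_on_eq_continuous_within by blast
  qed (auto intro: continuous_on_snd continuous_on_id)
  have "Ck_family UNIV {0..S0} k (\<lambda>_. (D_on {0..S0} ^^ j) h)" for k j
  proof (induction k arbitrary: j)
    case (Suc k)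
    show ?case
      by (rule Ck_family_SucI[OF cont Ck_family_const[of _ _ _ 0] Suc.IH[of "Suc j"]])
        (simp, rule der)
  qed (simp add: cont)
  from this[of _ 0] show "smooth_family UNIV {0..S0} (\<lambda>_. h)"
    by (simp add: smooth_family_def)
next
  assume h: "smooth_family UNIV {0..S0} (\<lambda>_. h)"
  have "smooth_family UNIV {0..S0} (\<lambda>_. (D_on {0..S0} ^^ k) h)" for k
    by (induction k) (auto intro: h smooth_family_D_on assms)
  from smooth_family_has_D_on[OF this assms UNIV_I] show "smooth_curve_on {0..S0} h"
    unfolding smooth_curve_on_def by (blast intro: differentiableI_vector)
qed

text \<open>The tube lemma: compactness of \<open>K\<close> makes the neighbourhood of
  \<open>t0\<close> uniform in \<open>s\<close>. It is applied to keep the curvature positive and to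
  keep the jets inside \<open>U\<close> for small \<open>t\<close>.\<close>

lemma continuous_on_near_slice:
  fixes f :: "'a::topological_space \<times> 'b::topological_space \<Rightarrow> 'c::topological_space"
  assumes "continuous_on (T \<times> K) f" "open T" "t0 \<in> T" "compact K" "open W"
    and "\<And>s. s \<in> K \<Longrightarrow> f (t0, s) \<in> W"
  obtains T' where "open T'" "t0 \<in> T'" "T' \<subseteq> T" "\<And>t s. t \<in> T' \<Longrightarrow> s \<in> K \<Longrightarrow> f (t, s) \<in> W"
proof -
  obtain A where A: "open A" "A \<inter> (T \<times> K) = f -` W \<inter> (T \<times> K)"
    using assms(1,5) unfolding continuous_on_open_invariant by blast
  have "{t0} \<times> K \<subseteq> A"
    using A(2) assms(3,6) by blast
  from Elementary_Topology.tube_lemma[OF assms(4) A(1) this] obtain X where X: "t0 \<in> X" "open X" "X \<times> K \<subseteq> A"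
    by blast
  show ?thesis
  proof
    show "open (X \<inter> T)" "t0 \<in> X \<inter> T" "X \<inter> T \<subseteq> T"
      using X assms by auto
    show "f (t, s) \<in> W" if "t \<in> X \<inter> T" "s \<in> K" for t s
      using A(2) X(3) that by blast
  qed
qed

section \<open>Frenet data of perturbed curves\<close>

lemma parameter_D_bilinear:
  assumes "bounded_bilinear B" "smooth_family T I F" "smooth_family T I G" "t \<in> T" "s \<in> I"
  shows "parameter_D (\<lambda>t s. B (F t s) (G t s)) t s
    = B (F t s) (parameter_D G t s) + B (parameter_D F t s) (G t s)"
  by (rule parameter_D_eq)
    (intro bounded_bilinear.has_vector_derivative[OF assms(1)] smooth_family_has_parameter_D[OF _ assms(4,5)] assms(2,3))

lemma parameter_D_cong:
  assumes "smooth_family T I F" "open T" "t \<in> T" "s \<in> I" "\<And>t. t \<in> T \<Longrightarrow> F t s = G t s"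
  shows "parameter_D G t s = parameter_D F t s"
  by (rule parameter_D_eq)
    (rule has_vector_derivative_transform_within_open[OF smooth_family_has_parameter_D[OF assms(1,3,4)] assms(2,3,5)])

lemma parameter_D_const: "parameter_D (\<lambda>t s. c s) t s = 0"
  by (rule parameter_D_eq) simp

lemma D_on_bilinear:
  assumes "bounded_bilinear B" "0 < S0" "s \<in> {0..S0}"
    and "smooth_family UNIV {0..S0} (\<lambda>_. F)" "smooth_family UNIV {0..S0} (\<lambda>_. G)"
  shows "D_on {0..S0} (\<lambda>s. B (F s) (G s)) s = B (F s) (D_on {0..S0} G s) + B (D_on {0..S0} F s) (G s)"
  by (rule D_on_eq[OF _ assms(2,3)])
    (intro bounded_bilinear.has_vector_derivative[OF assms(1)]
      smooth_family_has_D_on[OF assms(4,2) UNIV_I assms(3)] smooth_family_has_D_on[OF assms(5,2) UNIV_I assms(3)])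

lemma D_on_const:
  assumes "0 < S0" "s \<in> {0..S0}"
  shows "D_on {0..S0} (\<lambda>s. c) s = 0"
  by (rule D_on_eq[OF _ assms]) simp

lemma smooth_speed:
  assumes "smooth_family T {0..S0} \<gamma>" "open T" "0 < S0"
    and "\<And>t s. t \<in> T \<Longrightarrow> s \<in> {0..S0} \<Longrightarrow> speed {0..S0} (\<gamma> t) s \<noteq> 0"
  shows "smooth_family T {0..S0} (\<lambda>t. speed {0..S0} (\<gamma> t))"
  unfolding speed_def[abs_def] using assms
  by (intro smooth_family_norm smooth_family_D_on) (auto simp: speed_def)

lemma smooth_arc_D:
  assumes "smooth_family T {0..S0} \<gamma>" "open T" "0 < S0"
    and "\<And>t s. t \<in> T \<Longrightarrow> s \<in> {0..S0} \<Longrightarrow> speed {0..S0} (\<gamma> t) s \<noteq> 0"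
    and "smooth_family T {0..S0} F"
  shows "smooth_family T {0..S0} (\<lambda>t. arc_D {0..S0} (\<gamma> t) (F t))"
  unfolding arc_D_def[abs_def] using assms
  by (intro smooth_family_scaleR smooth_family_inverse smooth_speed smooth_family_D_on) auto

lemma smooth_arc_D_funpow:
  assumes "smooth_family T {0..S0} \<gamma>" "open T" "0 < S0"
    and "\<And>t s. t \<in> T \<Longrightarrow> s \<in> {0..S0} \<Longrightarrow> speed {0..S0} (\<gamma> t) s \<noteq> 0"
    and "smooth_family T {0..S0} F"
  shows "smooth_family T {0..S0} (\<lambda>t. (arc_D {0..S0} (\<gamma> t) ^^ k) (F t))"
  by (induction k) (auto intro: smooth_arc_D[OF assms(1-4)] assms(5))

text \<open>The Frenet data divide by the speed and the curvature; where neither vanishes they are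
  smooth jointly in \<open>t\<close> and \<open>s\<close>.\<close>

locale regular_family =
  fixes T :: "real set" and S0 :: real and \<gamma> :: "real \<Rightarrow> real \<Rightarrow> real^3"
  assumes S0: "0 < S0" and T: "open T" and \<gamma>: "smooth_family T {0..S0} \<gamma>"
    and speed: "t \<in> T \<Longrightarrow> s \<in> {0..S0} \<Longrightarrow> speed {0..S0} (\<gamma> t) s \<noteq> 0"
    and curvature: "t \<in> T \<Longrightarrow> s \<in> {0..S0} \<Longrightarrow> curvature {0..S0} (\<gamma> t) s \<noteq> 0"
begin

lemma smooth_family_arc_D [smooth_intros]:
  "smooth_family T {0..S0} F \<Longrightarrow> smooth_family T {0..S0} (\<lambda>t. arc_D {0..S0} (\<gamma> t) (F t))"
  by (rule smooth_arc_D[OF \<gamma> T S0 speed])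

lemma smooth_family_speed [smooth_intros]: "smooth_family T {0..S0} (\<lambda>t. speed {0..S0} (\<gamma> t))"
  by (rule smooth_speed[OF \<gamma> T S0 speed])

lemma smooth_family_tangent [smooth_intros]: "smooth_family T {0..S0} (\<lambda>t. tangent {0..S0} (\<gamma> t))"
  unfolding tangent_def by (intro smooth_family_arc_D \<gamma>)

lemma smooth_family_curvature [smooth_intros]:
  "smooth_family T {0..S0} (\<lambda>t. curvature {0..S0} (\<gamma> t))"
  unfolding curvature_def[abs_def]
  by (intro smooth_family_norm smooth_family_arc_D smooth_family_tangent)
    (use curvature in \<open>auto simp: curvature_def\<close>)

lemma smooth_family_normal [smooth_intros]: "smooth_family T {0..S0} (\<lambda>t. normal {0..S0} (\<gamma> t))"
  unfolding normal_def[abs_def]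
  by (intro smooth_family_scaleR smooth_family_inverse smooth_family_curvature smooth_family_arc_D
      smooth_family_tangent curvature)

lemma smooth_family_binormal [smooth_intros]:
  "smooth_family T {0..S0} (\<lambda>t. binormal {0..S0} (\<gamma> t))"
  unfolding binormal_def[abs_def]
  by (intro smooth_family_cross3 smooth_family_normal smooth_family_tangent)

lemma smooth_family_torsion [smooth_intros]:
  "smooth_family T {0..S0} (\<lambda>t. torsion {0..S0} (\<gamma> t))"
  unfolding torsion_def[abs_def]
  by (intro smooth_family_inner smooth_family_arc_D smooth_family_normal smooth_family_binormal)

lemma smooth_family_jet: "smooth_family T {0..S0} (\<lambda>t s. jet {0..S0} (\<gamma> t) s v)"
  by (cases v) (auto simp: jet_def intro: smooth_family_position
      smooth_arc_D_funpow[OF \<gamma> T S0 speed] smooth_family_curvature smooth_family_torsion)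

lemma inner_normal_normal:
  "t \<in> T \<Longrightarrow> s \<in> {0..S0} \<Longrightarrow> normal {0..S0} (\<gamma> t) s \<bullet> normal {0..S0} (\<gamma> t) s = 1"
  using curvature[of t s] by (simp add: normal_def curvature_def dot_square_norm power2_eq_square field_simps)

lemma arc_D_tangent:
  "t \<in> T \<Longrightarrow> s \<in> {0..S0} \<Longrightarrow> arc_D {0..S0} (\<gamma> t) (tangent {0..S0} (\<gamma> t)) s
    = curvature {0..S0} (\<gamma> t) s *\<^sub>R normal {0..S0} (\<gamma> t) s"
  using curvature[of t s] by (simp add: normal_def)

end

text \<open>The residual \<open>w\<close> is orthogonal to the whole frame. By Lagrange's identity
  its cross product with \<open>cross3 t n\<close> vanishes too, and a vector both orthogonal and
  parallel to a nonzero vector is zero.\<close>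

lemma orthonormal_frame_expansion:
  fixes t n v :: "real^3"
  assumes "t \<bullet> t = 1" "n \<bullet> n = 1" "t \<bullet> n = 0"
  shows "v = (v \<bullet> t) *\<^sub>R t + (v \<bullet> n) *\<^sub>R n + (v \<bullet> cross3 t n) *\<^sub>R cross3 t n"
proof -
  let ?b = "cross3 t n"
  have b: "?b \<bullet> ?b = 1" "?b \<bullet> t = 0" "?b \<bullet> n = 0" "n \<bullet> t = 0" "t \<bullet> ?b = 0" "n \<bullet> ?b = 0"
    using assms by (simp_all add: dot_cross dot_cross_self inner_commute)
  define w where "w = v - ((v \<bullet> t) *\<^sub>R t + (v \<bullet> n) *\<^sub>R n + (v \<bullet> ?b) *\<^sub>R ?b)"
  have "w \<bullet> t = 0" "w \<bullet> n = 0" "w \<bullet> ?b = 0"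
    using assms b by (simp_all add: w_def inner_diff_left inner_add_left)
  moreover from this have "cross3 w ?b = 0"
    by (simp add: Lagrange)
  moreover have "?b \<noteq> 0"
    using b(1) by auto
  ultimately have "w = 0"
    using norm_and_cross_eq_0 by blast
  then show ?thesis
    by (simp add: w_def)
qed

section \<open>The unit-speed crease and its Frenet equations\<close>

locale unit_speed_crease =
  fixes S0 :: real and r :: "real \<Rightarrow> real^3"
  assumes S0: "0 < S0" and r_smooth: "smooth_curve_on {0..S0} r"
    and r_arclength: "s \<in> {0..S0} \<Longrightarrow> norm (D_on {0..S0} r s) = 1"
    and \<kappa>_pos: "s \<in> {0..S0} \<Longrightarrow> 0 < curvature {0..S0} r s"
begin

abbreviation d :: "(real \<Rightarrow> 'a::real_normed_vector) \<Rightarrow> real \<Rightarrow> 'a" where "d \<equiv> D_on {0..S0}"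
abbreviation smooth :: "(real \<Rightarrow> 'a::real_normed_vector) \<Rightarrow> bool"
  where "smooth h \<equiv> smooth_family UNIV {0..S0} (\<lambda>_. h)"
abbreviation \<kappa> where "\<kappa> \<equiv> curvature {0..S0} r"
abbreviation \<tau> where "\<tau> \<equiv> torsion {0..S0} r"
abbreviation tang where "tang \<equiv> tangent {0..S0} r"
abbreviation nrml where "nrml \<equiv> normal {0..S0} r"
abbreviation bnrm where "bnrm \<equiv> binormal {0..S0} r"

lemma speed_eq_1: "s \<in> {0..S0} \<Longrightarrow> speed {0..S0} r s = 1"
  by (simp add: speed_def r_arclength)

lemma arc_D_eq: "s \<in> {0..S0} \<Longrightarrow> arc_D {0..S0} r h s = d h s"
  by (simp add: arc_D_def speed_eq_1)

text \<open>The crease is read as a family constant in the parameter, so the smoothness of its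
  Frenet data is a special case of that for families.\<close>

sublocale static: regular_family UNIV S0 "\<lambda>_. r"
  using S0 r_smooth \<kappa>_pos by unfold_locales (force simp: smooth_curve_on_iff speed_eq_1)+

lemmas d_inner = D_on_bilinear[OF bounded_bilinear_inner S0]
lemmas d_mult = D_on_bilinear[OF bounded_bilinear_mult S0]
lemmas d_scaleR = D_on_bilinear[OF bounded_bilinear_scaleR S0]
lemmas d_cross3 = D_on_bilinear[OF bounded_bilinear_cross3 S0]

lemma smooth_d [smooth_intros]: "smooth h \<Longrightarrow> smooth (d h)"
  by (rule smooth_family_D_on[OF _ S0 open_UNIV])

lemma has_d: "smooth h \<Longrightarrow> s \<in> {0..S0} \<Longrightarrow> (h has_vector_derivative d h s) (at s within {0..S0})"
  using smooth_family_has_D_on[OF _ S0 UNIV_I] .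

lemma d_eq: "(h has_vector_derivative h') (at s within {0..S0}) \<Longrightarrow> s \<in> {0..S0} \<Longrightarrow> d h s = h'"
  using D_on_eq[OF _ S0] .

lemma d_add: "smooth F \<Longrightarrow> smooth G \<Longrightarrow> s \<in> {0..S0} \<Longrightarrow> d (\<lambda>x. F x + G x) s = d F s + d G s"
  by (rule d_eq) (intro has_vector_derivative_add has_d)

lemma d_diff: "smooth F \<Longrightarrow> smooth G \<Longrightarrow> s \<in> {0..S0} \<Longrightarrow> d (\<lambda>x. F x - G x) s = d F s - d G s"
  by (rule d_eq) (intro has_vector_derivative_diff has_d)

lemma d_minus: "smooth F \<Longrightarrow> s \<in> {0..S0} \<Longrightarrow> d (\<lambda>x. - F x) s = - d F s"
  by (rule d_eq) (intro has_vector_derivative_minus has_d)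

lemma tangent_eq: "s \<in> {0..S0} \<Longrightarrow> tang s = d r s"
  by (simp add: tangent_def arc_D_eq)

lemma smooth_frame [smooth_intros]: "smooth tang" "smooth nrml" "smooth bnrm" "smooth \<kappa>" "smooth \<tau>"
  by (fact static.smooth_family_tangent static.smooth_family_normal static.smooth_family_binormal
      static.smooth_family_curvature static.smooth_family_torsion)+

text \<open>Differentiating \<open>t . t = 1\<close> gives the orthogonality of tangent and normal;
  everything about the binormal then follows from cross product identities.\<close>

lemma orthonormal:
  assumes s: "s \<in> {0..S0}"
  shows "tang s \<bullet> tang s = 1" "nrml s \<bullet> nrml s = 1" "bnrm s \<bullet> bnrm s = 1"
    "tang s \<bullet> nrml s = 0" "nrml s \<bullet> tang s = 0" "tang s \<bullet> bnrm s = 0" "bnrm s \<bullet> tang s = 0"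
    "nrml s \<bullet> bnrm s = 0" "bnrm s \<bullet> nrml s = 0"
proof -
  have tt: "tang x \<bullet> tang x = 1" if "x \<in> {0..S0}" for x
    using r_arclength[OF that] by (simp add: tangent_eq[OF that] dot_square_norm)
  have "d (\<lambda>x. tang x \<bullet> tang x) s = d (\<lambda>x. 1) s"
    by (rule D_on_cong[OF tt s])
  then have "tang s \<bullet> d tang s = 0"
    using d_inner[OF s smooth_frame(1,1)] by (simp add: D_on_const[OF S0 s] inner_commute)
  then have tn: "tang s \<bullet> nrml s = 0"
    by (simp add: normal_def arc_D_eq[OF s])
  moreover have nn: "nrml s \<bullet> nrml s = 1"
    using static.inner_normal_normal[OF UNIV_I s] .
  ultimately show "tang s \<bullet> tang s = 1" "nrml s \<bullet> nrml s = 1" "bnrm s \<bullet> bnrm s = 1"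
    "tang s \<bullet> nrml s = 0" "nrml s \<bullet> tang s = 0" "tang s \<bullet> bnrm s = 0" "bnrm s \<bullet> tang s = 0"
    "nrml s \<bullet> bnrm s = 0" "bnrm s \<bullet> nrml s = 0"
    using tt[OF s] by (simp_all add: binormal_def dot_cross dot_cross_self inner_commute)
qed

lemma frenet_tangent: "s \<in> {0..S0} \<Longrightarrow> d tang s = \<kappa> s *\<^sub>R nrml s"
  using static.arc_D_tangent[OF UNIV_I] by (simp add: arc_D_eq)

text \<open>Differentiating \<open>n . n = 1\<close> and \<open>t . n = 0\<close> yields two
  components of the derivative; the third is the torsion by definition.\<close>

lemma frenet_normal:
  assumes s: "s \<in> {0..S0}"
  shows "d nrml s = - \<kappa> s *\<^sub>R tang s + \<tau> s *\<^sub>R bnrm s"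
proof -
  have "d (\<lambda>x. nrml x \<bullet> nrml x) s = d (\<lambda>x. 1) s" "d (\<lambda>x. tang x \<bullet> nrml x) s = d (\<lambda>x. 0) s"
    by (rule D_on_cong[OF _ s], simp add: orthonormal)+
  then have "d nrml s \<bullet> nrml s = 0" "d nrml s \<bullet> tang s = - \<kappa> s"
    using d_inner[OF s smooth_frame(2,2)] d_inner[OF s smooth_frame(1,2)]
    by (simp_all add: D_on_const[OF S0 s] inner_commute frenet_tangent[OF s] orthonormal[OF s])
  moreover have "d nrml s \<bullet> bnrm s = \<tau> s"
    by (simp add: torsion_def arc_D_eq[OF s])
  ultimately show ?thesis
    using orthonormal_frame_expansion[OF orthonormal(1,2,4)[OF s], of "d nrml s"]
    by (simp flip: binormal_def)
qed

lemma cross_frame: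
  assumes s: "s \<in> {0..S0}"
  shows "cross3 (tang s) (bnrm s) = - nrml s" "cross3 (nrml s) (bnrm s) = tang s"
    "cross3 (bnrm s) (tang s) = nrml s"
  using orthonormal[OF s] cross_skew[of "bnrm s" "tang s"]
  by (simp_all add: binormal_def Lagrange)

lemma frenet_binormal:
  assumes s: "s \<in> {0..S0}"
  shows "d bnrm s = - \<tau> s *\<^sub>R nrml s"
proof -
  have "d bnrm s = cross3 (tang s) (d nrml s) + cross3 (d tang s) (nrml s)"
    unfolding binormal_def[abs_def] by (rule d_cross3[OF s smooth_frame(1,2)])
  also have "\<dots> = - \<tau> s *\<^sub>R nrml s"
    by (simp add: frenet_normal[OF s] frenet_tangent[OF s] cross_add_right cross_mult_right
        Cross3.right_diff_distrib cross_mult_left cross_frame[OF s])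
  finally show ?thesis .
qed

end


section \<open>Curves perturbed by an inextensible displacement\<close>

locale inextensible_variation = unit_speed_crease S0 r for S0 r +
  fixes \<eta> :: "real \<Rightarrow> real^3"
  assumes \<eta>_smooth: "smooth_curve_on {0..S0} \<eta>"
    and inextensible: "s \<in> {0..S0} \<Longrightarrow> D_on {0..S0} r s \<bullet> D_on {0..S0} \<eta> s = 0"
begin

abbreviation \<gamma> :: "real \<Rightarrow> real \<Rightarrow> real^3" where "\<gamma> \<equiv> \<lambda>t s. r s + t *\<^sub>R \<eta> s"

lemma smooth_\<eta> [smooth_intros]: "smooth \<eta>"
  using \<eta>_smooth S0 by (simp add: smooth_curve_on_iff)

lemma smooth_r: "smooth r"
  using r_smooth S0 by (simp add: smooth_curve_on_iff)

lemma smooth_family_\<gamma>: "smooth_family T {0..S0} \<gamma>"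
  using smooth_family_mono[of UNIV _ _ T] smooth_r smooth_\<eta>
  by (intro smooth_family_add smooth_family_scaleR smooth_family_parameter) auto

text \<open>Inextensibility removes the term linear in \<open>t\<close>. Consequently the speed is
  at least 1 for every \<open>t\<close>, not just for small ones.\<close>

lemma speed_\<gamma>:
  assumes s: "s \<in> {0..S0}"
  shows "speed {0..S0} (\<gamma> t) s = sqrt (1 + t\<^sup>2 * (norm (d \<eta> s))\<^sup>2)"
proof -
  have "d (\<gamma> t) s = d r s + t *\<^sub>R d \<eta> s"
    by (rule d_eq[OF _ s])
      (auto intro!: derivative_eq_intros has_d[OF _ s] smooth_r smooth_\<eta>)
  moreover have "d r s \<bullet> d r s = 1"
    using r_arclength[OF s] by (simp add: dot_square_norm)
  ultimately show ?thesis
    using inextensible[OF s]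
    by (simp add: speed_def norm_eq_sqrt_inner inner_add_left inner_add_right inner_commute
        power2_eq_square algebra_simps)
qed

lemma speed_\<gamma>_pos: "s \<in> {0..S0} \<Longrightarrow> speed {0..S0} (\<gamma> t) s > 0"
  by (simp add: speed_\<gamma> add_pos_nonneg)

lemma speed_\<gamma>_nonzero: "s \<in> {0..S0} \<Longrightarrow> speed {0..S0} (\<gamma> t) s \<noteq> 0"
  using speed_\<gamma>_pos[of s t] by simp

text \<open>The speed never vanishes, so only the curvature restricts \<open>t\<close>; being
  positive on the compact interval at \<open>t = 0\<close>, it remains so for all parameters close
  to 0.\<close>

lemma regular_near_0:
  obtains T where "0 \<in> T" "regular_family T S0 \<gamma>"
proof -
  let ?A = "\<lambda>t. arc_D {0..S0} (\<gamma> t) (tangent {0..S0} (\<gamma> t))"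
  have "smooth_family UNIV {0..S0} ?A"
    unfolding tangent_def
    by (intro smooth_arc_D smooth_family_\<gamma> S0 open_UNIV speed_\<gamma>_nonzero)
  then have "continuous_on (UNIV \<times> {0..S0}) (\<lambda>x. norm (?A (fst x) (snd x)))"
    by (intro continuous_on_norm smooth_family_continuous)
  then obtain T where T: "open T" "0 \<in> T"
    "\<And>t s. t \<in> T \<Longrightarrow> s \<in> {0..S0} \<Longrightarrow> norm (?A (fst (t, s)) (snd (t, s))) \<in> {0<..}"
    by (rule continuous_on_near_slice[of _ _ _ 0 "{0<..}"])
      (use \<kappa>_pos in \<open>auto simp: curvature_def\<close>)
  have "regular_family T S0 \<gamma>"
  proof
    show "curvature {0..S0} (\<gamma> t) s \<noteq> 0" if "t \<in> T" "s \<in> {0..S0}" for t s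
      using T(3)[OF that] by (simp add: curvature_def)
  qed (rule S0 T smooth_family_\<gamma> speed_\<gamma>_nonzero | assumption)+
  with T(2) show ?thesis by (rule that)
qed

end

section \<open>First variation of the Frenet data and of their arclength derivatives\<close>

locale regular_variation = inextensible_variation S0 r \<eta> +
    perturbed: regular_family T S0 "\<lambda>t s. r s + t *\<^sub>R \<eta> s" for S0 r \<eta> T +
  assumes zero: "0 \<in> T"
begin

lemma smooth_family_at_0: "smooth_family T {0..S0} F \<Longrightarrow> smooth (F 0)"
  using smooth_family_slice[OF _ zero] .

lemma smooth_variation: "smooth_family T {0..S0} F \<Longrightarrow> smooth (parameter_D F 0)"
  by (rule smooth_family_at_0[OF smooth_family_parameter_D[OF _ perturbed.T]])

lemma variation_speed:
  assumes s: "s \<in> {0..S0}"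
  shows "((\<lambda>t. speed {0..S0} (\<gamma> t) s) has_real_derivative 0) (at 0)"
  unfolding speed_\<gamma>[OF s] by (auto intro!: derivative_eq_intros)

text \<open>The speed is 1 and stationary at \<open>t = 0\<close>, so the normalising factor
  contributes nothing; what remains is the commutation of mixed partial derivatives.\<close>

lemma variation_arc_D:
  fixes F :: "real \<Rightarrow> real \<Rightarrow> 'b::banach"
  assumes F: "smooth_family T {0..S0} F" and s: "s \<in> {0..S0}"
  shows "parameter_D (\<lambda>t. arc_D {0..S0} (\<gamma> t) (F t)) 0 s = d (parameter_D F 0) s"
proof (rule parameter_D_eq)
  have "((\<lambda>t. d (F t) s) has_vector_derivative d (parameter_D F 0) s) (at 0)"
    using smooth_family_has_parameter_D[OF smooth_family_D_on[OF F S0 perturbed.T] zero s]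
      D_on_parameter_D[OF F S0 perturbed.T zero s] by simp
  moreover have "((\<lambda>t. inverse (speed {0..S0} (\<gamma> t) s)) has_real_derivative 0) (at 0)"
    using DERIV_inverse'[OF variation_speed[OF s]] speed_eq_1[OF s] by simp
  ultimately show "((\<lambda>t. arc_D {0..S0} (\<gamma> t) (F t) s) has_vector_derivative d (parameter_D F 0) s) (at 0)"
    using has_vector_derivative_scaleR speed_eq_1[OF s] by (fastforce simp: arc_D_def)
qed

lemma variation_tangent:
  assumes s: "s \<in> {0..S0}"
  shows "parameter_D (\<lambda>t. tangent {0..S0} (\<gamma> t)) 0 s = d \<eta> s"
proof -
  have "parameter_D \<gamma> 0 x = \<eta> x" for x
    by (rule parameter_D_eq) (auto intro!: derivative_eq_intros)
  then have "parameter_D \<gamma> 0 = \<eta>" by blast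
  then show ?thesis
    unfolding tangent_def using variation_arc_D[OF smooth_family_\<gamma> s] by simp
qed

abbreviation \<nu> where "\<nu> \<equiv> parameter_D (\<lambda>t. normal {0..S0} (\<gamma> t)) 0"
abbreviation \<delta>\<kappa> where "\<delta>\<kappa> \<equiv> parameter_D (\<lambda>t. curvature {0..S0} (\<gamma> t)) 0"
abbreviation \<delta>\<tau> where "\<delta>\<tau> \<equiv> parameter_D (\<lambda>t. torsion {0..S0} (\<gamma> t)) 0"

lemma normal_variation_normal:
  assumes s: "s \<in> {0..S0}"
  shows "nrml s \<bullet> \<nu> s = 0"
proof -
  have "parameter_D (\<lambda>t s. normal {0..S0} (\<gamma> t) s \<bullet> normal {0..S0} (\<gamma> t) s) 0 s
      = parameter_D (\<lambda>t s. 1) 0 s"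
    by (rule parameter_D_cong[OF smooth_family_const perturbed.T zero s])
      (rule perturbed.inner_normal_normal[OF _ s, symmetric])
  then show ?thesis
    unfolding parameter_D_const using parameter_D_bilinear[OF bounded_bilinear_inner perturbed.smooth_family_normal
        perturbed.smooth_family_normal zero s]
    by (simp add: inner_commute)
qed

text \<open>This is the variation of \<open>t' = \<kappa> n\<close>: the left side commutes with the
  derivative, the right side follows the product rule. Its normal and binormal components give
  \<open>\<delta>\<kappa>\<close> and \<open>bnrm \<bullet> \<nu>\<close>.\<close>

lemma d_d_\<eta>:
  assumes s: "s \<in> {0..S0}"
  shows "d (d \<eta>) s = \<delta>\<kappa> s *\<^sub>R nrml s + \<kappa> s *\<^sub>R \<nu> s"
proof -
  have "d (d \<eta>) s = d (parameter_D (\<lambda>t. tangent {0..S0} (\<gamma> t)) 0) s"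
    by (rule D_on_cong[OF _ s]) (simp add: variation_tangent)
  also have "\<dots> = parameter_D (\<lambda>t. arc_D {0..S0} (\<gamma> t) (tangent {0..S0} (\<gamma> t))) 0 s"
    by (rule variation_arc_D[OF perturbed.smooth_family_tangent s, symmetric])
  also have "\<dots> = parameter_D (\<lambda>t s. curvature {0..S0} (\<gamma> t) s *\<^sub>R normal {0..S0} (\<gamma> t) s) 0 s"
    by (rule parameter_D_cong[OF smooth_family_scaleR[OF perturbed.smooth_family_curvature
            perturbed.smooth_family_normal] perturbed.T zero s])
      (rule perturbed.arc_D_tangent[OF _ s, symmetric])
  also have "\<dots> = \<delta>\<kappa> s *\<^sub>R nrml s + \<kappa> s *\<^sub>R \<nu> s"
    using parameter_D_bilinear[OF bounded_bilinear_scaleR perturbed.smooth_family_curvature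
        perturbed.smooth_family_normal zero s] by simp
  finally show ?thesis .
qed

lemma variation_curvature:
  assumes s: "s \<in> {0..S0}"
  shows "\<delta>\<kappa> s = nrml s \<bullet> d (d \<eta>) s"
  by (simp add: d_d_\<eta>[OF s] inner_add_right orthonormal[OF s] normal_variation_normal[OF s])

text \<open>Vary \<open>\<tau> = n' . b\<close>. The term with the varied binormal leaves
  \<open>\<kappa> (b . \<eta>')\<close>; the other is \<open>b . \<nu>'\<close>, which equals
  \<open>(b . \<nu>)'\<close> because \<open>b'\<close> is parallel to \<open>n\<close> and
  \<open>\<nu>\<close> is orthogonal to \<open>n\<close>.\<close>

lemma variation_torsion:
  assumes s: "s \<in> {0..S0}"
  shows "\<delta>\<tau> s = d (\<lambda>x. bnrm x \<bullet> d (d \<eta>) x / \<kappa> x) s + \<kappa> s * (bnrm s \<bullet> d \<eta> s)"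
proof -
  note fam = perturbed.smooth_family_tangent perturbed.smooth_family_normal
    perturbed.smooth_family_binormal
  have db: "parameter_D (\<lambda>t. binormal {0..S0} (\<gamma> t)) 0 s
      = cross3 (tang s) (\<nu> s) + cross3 (d \<eta> s) (nrml s)"
    unfolding binormal_def[abs_def]
    using parameter_D_bilinear[OF bounded_bilinear_cross3 fam(1,2) zero s]
    by (simp add: variation_tangent[OF s])
  have "\<delta>\<tau> s = d nrml s \<bullet> parameter_D (\<lambda>t. binormal {0..S0} (\<gamma> t)) 0 s + d \<nu> s \<bullet> bnrm s"
    unfolding torsion_def[abs_def]
    using parameter_D_bilinear[OF bounded_bilinear_inner perturbed.smooth_family_arc_D[OF fam(2)]
        fam(3) zero s]
    by (simp add: variation_arc_D[OF fam(2) s] arc_D_eq[OF s])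
  moreover have "d nrml s \<bullet> (cross3 (tang s) (\<nu> s) + cross3 (d \<eta> s) (nrml s)) = \<kappa> s * (bnrm s \<bullet> d \<eta> s)"
  proof -
    have "tang s \<bullet> cross3 (d \<eta> s) (nrml s) = - (bnrm s \<bullet> d \<eta> s)"
      using cross_triple[of "d \<eta> s" "nrml s" "tang s"] cross_skew[of "nrml s" "tang s"]
      by (simp add: binormal_def inner_commute)
    moreover have "bnrm s \<bullet> cross3 (d \<eta> s) (nrml s) = 0"
      using cross_triple[of "d \<eta> s" "nrml s" "bnrm s"] inextensible[OF s]
      by (simp add: cross_frame[OF s] tangent_eq[OF s] inner_commute)
    moreover have "bnrm s \<bullet> cross3 (tang s) (\<nu> s) = 0"
      using cross_triple[of "bnrm s" "tang s" "\<nu> s"] cross_triple[of "tang s" "\<nu> s" "bnrm s"]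
      by (simp add: cross_frame[OF s] normal_variation_normal[OF s] inner_commute)
    ultimately show ?thesis
      by (simp add: frenet_normal[OF s] inner_add_left inner_add_right inner_diff_left dot_cross_self)
  qed
  moreover have "d (\<lambda>x. bnrm x \<bullet> d (d \<eta>) x / \<kappa> x) s = d \<nu> s \<bullet> bnrm s"
  proof -
    have "bnrm x \<bullet> d (d \<eta>) x / \<kappa> x = bnrm x \<bullet> \<nu> x" if "x \<in> {0..S0}" for x
      using \<kappa>_pos[OF that] by (simp add: d_d_\<eta>[OF that] inner_add_right orthonormal[OF that])
    from D_on_cong[OF this s] have "d (\<lambda>x. bnrm x \<bullet> d (d \<eta>) x / \<kappa> x) s = d (\<lambda>x. bnrm x \<bullet> \<nu> x) s" .
    also have "\<dots> = bnrm s \<bullet> d \<nu> s + d bnrm s \<bullet> \<nu> s"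
      by (rule d_inner[OF s smooth_frame(3) smooth_variation[OF fam(2)]])
    finally show ?thesis
      by (simp add: frenet_binormal[OF s] normal_variation_normal[OF s] inner_commute)
  qed
  ultimately show ?thesis
    by (simp add: db)
qed

lemma variation_arc_D_funpow:
  fixes F :: "real \<Rightarrow> real \<Rightarrow> 'b::banach"
  assumes F: "smooth_family T {0..S0} F" and s: "s \<in> {0..S0}"
  shows "parameter_D (\<lambda>t. (arc_D {0..S0} (\<gamma> t) ^^ k) (F t)) 0 s = (d ^^ k) (parameter_D F 0) s"
  using s
proof (induction k arbitrary: s)
  case (Suc k)
  have "smooth_family T {0..S0} (\<lambda>t. (arc_D {0..S0} (\<gamma> t) ^^ k) (F t))"
    by (rule smooth_arc_D_funpow[OF smooth_family_\<gamma> perturbed.T S0 perturbed.speed F])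
  from variation_arc_D[OF this Suc.prems] show ?case
    using D_on_cong[of "{0..S0}", OF Suc.IH Suc.prems] by simp
qed simp

text \<open>The slot \<open>Arclen\<close> carries the material label, which does not move under the
  perturbation.\<close>

lemma variation_jet:
  assumes s: "s \<in> {0..S0}"
  shows "parameter_D (\<lambda>t s. jet {0..S0} (\<gamma> t) s v) 0 s =
    (case v of Curv i \<Rightarrow> (d ^^ i) \<delta>\<kappa> s | Tors i \<Rightarrow> (d ^^ i) \<delta>\<tau> s | Arclen \<Rightarrow> 0)"
  using variation_arc_D_funpow[OF perturbed.smooth_family_curvature s]
    variation_arc_D_funpow[OF perturbed.smooth_family_torsion s]
  by (cases v) (simp_all add: jet_def parameter_D_const)

end

section \<open>A smooth bump function\<close>

text \<open>The classical flat function \<open>exp (-1/x)\<close>, extended by 0. The polynomial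
  factor in \<open>1/x\<close> makes the class closed under differentiation.\<close>

definition flat_exp :: "real poly \<Rightarrow> real \<Rightarrow> real"
  where "flat_exp p x = (if x > 0 then poly p (inverse x) * exp (- inverse x) else 0)"

lemma poly_over_exp_tendsto_0: "((\<lambda>y. poly p y / exp y) \<longlongrightarrow> (0::real)) at_top"
proof -
  have "((\<lambda>y. \<Sum>i\<le>degree p. coeff p i * (y ^ i / exp y)) \<longlongrightarrow> (\<Sum>i\<le>degree p. coeff p i * 0)) at_top"
    by (intro tendsto_sum tendsto_mult tendsto_const tendsto_power_div_exp_0)
  then show ?thesis
    by (simp add: poly_altdef sum_divide_distrib)
qed

text \<open>With \<open>y = 1/x\<close> one has \<open>dy/dx = - y^2\<close>, so
  \<open>p(y) exp(-y)\<close> has the derivative \<open>y^2 (p(y) - p'(y)) exp(-y)\<close>. At 0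
  both one-sided difference quotients tend to 0.\<close>

lemma flat_exp_has_derivative:
  "(flat_exp p has_real_derivative flat_exp (monom 1 2 * (p - pderiv p)) x) (at x)"
proof -
  consider "x > 0" | "x < 0" | "x = 0" by linarith
  then show ?thesis
  proof cases
    case 1
    have "((\<lambda>x. poly p (inverse x) * exp (- inverse x)) has_real_derivative
        flat_exp (monom 1 2 * (p - pderiv p)) x) (at x)"
      using 1 by (auto intro!: derivative_eq_intros poly_DERIV[THEN DERIV_chain2]
          simp: flat_exp_def poly_monom field_simps power2_eq_square)
    then show ?thesis
      by (rule has_field_derivative_transform_within_open[of _ _ _ "{0<..}"])
        (use 1 in \<open>auto simp: flat_exp_def\<close>)
  next
    case 2
    have "((\<lambda>x. 0) has_real_derivative flat_exp (monom 1 2 * (p - pderiv p)) x) (at x)"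
      using 2 by (simp add: flat_exp_def)
    then show ?thesis
      by (rule has_field_derivative_transform_within_open[of _ _ _ "{..<0}"])
        (use 2 in \<open>auto simp: flat_exp_def\<close>)
  next
    case 3
    have "((\<lambda>y. (flat_exp p y - flat_exp p 0) / (y - 0)) \<longlongrightarrow> 0) (at_right 0)"
    proof (rule Lim_transform_eventually)
      \<comment> \<open>Dividing by \<open>y\<close> is multiplying by \<open>1/y\<close>, which
        raises the polynomial by the factor \<open>[:0, 1:]\<close>; the exponential still
        dominates.\<close>
      show "((\<lambda>y. poly (p * [:0, 1:]) (inverse y) / exp (inverse y)) \<longlongrightarrow> 0) (at_right 0)"
        by (rule filterlim_compose[OF poly_over_exp_tendsto_0 filterlim_inverse_at_top_right])
      show "\<forall>\<^sub>F y in at_right 0. poly (p * [:0, 1:]) (inverse y) / exp (inverse y)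
          = (flat_exp p y - flat_exp p 0) / (y - 0)"
        by (rule eventually_at_right_less[THEN eventually_mono])
          (simp add: flat_exp_def exp_minus field_simps)
    qed
    moreover have "((\<lambda>y. (flat_exp p y - flat_exp p 0) / (y - 0)) \<longlongrightarrow> 0) (at_left 0)"
    proof (rule Lim_transform_eventually[OF tendsto_const])
      show "\<forall>\<^sub>F y in at_left 0. 0 = (flat_exp p y - flat_exp p 0) / (y - 0)"
        unfolding eventually_at_filter by (auto simp: flat_exp_def)
    qed
    ultimately show ?thesis
      using 3 by (simp add: has_field_derivative_iff filterlim_at_split flat_exp_def)
  qed
qed

lemma smooth_family_flat_exp: "smooth_family T I (\<lambda>t s. flat_exp p (c * s + e))"
proof -
  have der: "((\<lambda>s. flat_exp p (c * s + e)) has_vector_derivative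
      c * flat_exp (monom 1 2 * (p - pderiv p)) (c * s + e)) (at s within I)" for p s
  proof -
    have "((\<lambda>s. c * s + e) has_real_derivative c) (at s within I)"
      by (auto intro!: derivative_eq_intros)
    from DERIV_chain2[OF flat_exp_has_derivative this] show ?thesis
      by (simp add: has_real_derivative_iff_has_vector_derivative mult.commute)
  qed
  have cont: "continuous_on (T \<times> I) (\<lambda>x. flat_exp p (c * snd x + e))" for p
  proof (rule continuous_on_compose2[of UNIV "flat_exp p"])
    show "continuous_on UNIV (flat_exp p)"
      by (intro DERIV_continuous_on) (rule has_field_derivative_at_within[OF flat_exp_has_derivative])
  qed (auto intro!: continuous_intros)
  have "Ck_family T I k (\<lambda>t s. flat_exp p (c * s + e))" for k p
  proof (induction k arbitrary: p)
    case 0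
    then show ?case using cont by simp
  next
    case (Suc k)
    show ?case
      by (rule Ck_family_SucI[OF _ Ck_family_const[of _ _ _ 0]
            Ck_family_bilinear[OF bounded_bilinear_mult Ck_family_const[of _ _ _ c] Suc]])
        (rule der | simp add: cont)+
  qed
  then show ?thesis
    by (simp add: smooth_family_def)
qed

section \<open>The Euler-Lagrange expressions\<close>

context unit_speed_crease
begin

section \<open>Integration by parts without boundary terms\<close>

lemma continuous_smooth: "smooth u \<Longrightarrow> continuous_on {0..S0} u"
  using smooth_family_imp_continuous_on[OF _ UNIV_I] .

lemma integrable_smooth: "smooth (u :: real \<Rightarrow> 'b::banach) \<Longrightarrow> u integrable_on {0..S0}"
  by (intro integrable_continuous_interval continuous_smooth)

lemma smooth_d_funpow: "smooth u \<Longrightarrow> smooth ((d ^^ i) u)"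
  by (induction i) (auto intro: smooth_d)

lemma \<kappa>_nonzero: "s \<in> {0..S0} \<Longrightarrow> \<kappa> s \<noteq> 0"
  using \<kappa>_pos[of s] by simp

lemma integral_d_eq_0:
  assumes "smooth (Q :: real \<Rightarrow> 'b::banach)" "Q 0 = 0" "Q S0 = 0"
  shows "(d Q has_integral 0) {0..S0}"
  using fundamental_theorem_of_calculus[of 0 S0 Q "d Q"] has_d[OF assms(1)] assms(2,3) S0 by simp

text \<open>One derivative at a time moves from \<open>u\<close> to the other factor, so the
  induction must allow that factor to change.\<close>

lemma integral_by_parts_funpow:
  fixes p u :: "real \<Rightarrow> real"
  assumes "smooth p" and u: "smooth u"
    and ends: "\<And>j. (d ^^ j) u 0 = 0" "\<And>j. (d ^^ j) u S0 = 0"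
  shows "integral {0..S0} (\<lambda>s. p s * (d ^^ i) u s) = integral {0..S0} (\<lambda>s. (- 1) ^ i * (d ^^ i) p s * u s)"
  using assms(1)
proof (induction i arbitrary: p)
  case (Suc i)
  note p = Suc.prems
  let ?v = "(d ^^ i) u"
  note v = smooth_d_funpow[OF u, of i]
  have "integral {0..S0} (d (\<lambda>s. p s * ?v s)) = 0"
    by (rule integral_unique[OF integral_d_eq_0]) (intro smooth_intros p v, simp_all add: ends)
  moreover have "integral {0..S0} (d (\<lambda>s. p s * ?v s)) = integral {0..S0} (\<lambda>s. p s * d ?v s + d p s * ?v s)"
    by (rule integral_cong) (rule d_mult[OF _ p v])
  moreover have "\<dots> = integral {0..S0} (\<lambda>s. p s * d ?v s) + integral {0..S0} (\<lambda>s. d p s * ?v s)"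
    by (rule integral_add; rule integrable_smooth; intro smooth_intros p v)
  ultimately have "integral {0..S0} (\<lambda>s. p s * d ?v s) = - integral {0..S0} (\<lambda>s. d p s * ?v s)"
    by simp
  also have "\<dots> = - integral {0..S0} (\<lambda>s. (- 1) ^ i * (d ^^ i) (d p) s * u s)"
    using Suc.IH[OF smooth_d[OF p]] by simp
  also have "\<dots> = integral {0..S0} (\<lambda>s. (- 1) ^ Suc i * (d ^^ Suc i) p s * u s)"
    by (simp add: funpow_swap1 flip: integral_neg)
  finally show ?case by simp
qed simp

text \<open>Vanishing on neighbourhoods of the ends, rather than just at the ends, is inherited by
  all derivatives.\<close>

definition vanishes_near_ends :: "(real \<Rightarrow> 'a::real_normed_vector) \<Rightarrow> bool"
  where "vanishes_near_ends u \<longleftrightarrow> (\<exists>\<delta>>0. \<forall>s\<in>{0..S0}. s < \<delta> \<or> S0 - \<delta> < s \<longrightarrow> u s = 0)"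

lemma vanishes_near_ends_imp: "vanishes_near_ends u \<Longrightarrow> u 0 = 0 \<and> u S0 = 0"
  using S0 unfolding vanishes_near_ends_def by force

lemma d_eq_0_near:
  assumes "open W" "s \<in> W" "s \<in> {0..S0}" "\<And>x. x \<in> W \<Longrightarrow> x \<in> {0..S0} \<Longrightarrow> u x = 0"
  shows "d u s = 0"
proof (rule d_eq[OF _ assms(3)])
  obtain e where "e > 0" "ball s e \<subseteq> W"
    using assms(1,2) open_contains_ball by blast
  then have "\<And>x. x \<in> {0..S0} \<Longrightarrow> dist x s < e \<Longrightarrow> 0 = u x"
    using assms(4) by (force simp: dist_commute)
  from has_vector_derivative_transform_within[OF has_vector_derivative_const \<open>e > 0\<close> assms(3) this]
  show "(u has_vector_derivative 0) (at s within {0..S0})" .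
qed

lemma vanishes_near_ends_d:
  assumes "vanishes_near_ends u"
  shows "vanishes_near_ends (d u)"
proof -
  obtain \<delta> where \<delta>: "\<delta> > 0" "\<And>s. s \<in> {0..S0} \<Longrightarrow> s < \<delta> \<or> S0 - \<delta> < s \<Longrightarrow> u s = 0"
    using assms unfolding vanishes_near_ends_def by blast
  have "d u s = 0" if "s \<in> {0..S0}" "s < \<delta> \<or> S0 - \<delta> < s" for s
    by (rule d_eq_0_near[of "{..<\<delta>} \<union> {S0 - \<delta><..}"]) (use that \<delta>(2) in auto)
  with \<delta>(1) show ?thesis
    unfolding vanishes_near_ends_def by blast
qed

lemma vanishes_near_ends_funpow: "vanishes_near_ends u \<Longrightarrow> vanishes_near_ends ((d ^^ i) u)"
  by (induction i) (auto intro: vanishes_near_ends_d)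

lemma vanishes_near_ends_add:
  assumes "vanishes_near_ends u" "vanishes_near_ends v"
  shows "vanishes_near_ends (\<lambda>s. u s + v s)"
proof -
  obtain \<delta> \<delta>' where "\<delta> > 0" "\<And>s. s \<in> {0..S0} \<Longrightarrow> s < \<delta> \<or> S0 - \<delta> < s \<Longrightarrow> u s = 0"
    "\<delta>' > 0" "\<And>s. s \<in> {0..S0} \<Longrightarrow> s < \<delta>' \<or> S0 - \<delta>' < s \<Longrightarrow> v s = 0"
    using assms unfolding vanishes_near_ends_def by blast
  then show ?thesis
    unfolding vanishes_near_ends_def by (intro exI[of _ "min \<delta> \<delta>'"]) (auto simp: min_def)
qed

lemma vanishes_near_ends_mono:
  "vanishes_near_ends u \<Longrightarrow> (\<And>s. u s = 0 \<Longrightarrow> v s = 0) \<Longrightarrow> vanishes_near_ends v"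
  unfolding vanishes_near_ends_def by blast

definition EL_tangent :: "(real \<Rightarrow> real) \<Rightarrow> (real \<Rightarrow> real) \<Rightarrow> real \<Rightarrow> real"
  where "EL_tangent f g s = (let h = \<lambda>s. d g s / \<kappa> s in
      f s * d \<kappa> s + 2 * \<kappa> s * d f s
        + d (\<lambda>x. (- f x * (\<tau> x)\<^sup>2 - f x * (\<kappa> x)\<^sup>2 + d (d f) x) / \<kappa> x) s
        + g s * d \<tau> s + 2 * \<tau> s * d g s
        + d (\<lambda>x. (2 * \<tau> x * d h x + h x * d \<tau> x) / \<kappa> x) s)"

definition EL_binormal :: "(real \<Rightarrow> real) \<Rightarrow> (real \<Rightarrow> real) \<Rightarrow> real \<Rightarrow> real"
  where "EL_binormal f g s = (let h = \<lambda>s. d g s / \<kappa> s in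
      h s * (\<tau> s)\<^sup>2 - d (\<lambda>x. g x * \<kappa> x) s - d (d h) s + f s * d \<tau> s + 2 * \<tau> s * d f s)"

end

section \<open>The internal force and its derivative\<close>

locale stress_resultants = unit_speed_crease +
  fixes f g :: "real \<Rightarrow> real"
  assumes f: "smooth f" and g: "smooth g"
begin

definition h where "h s = d g s / \<kappa> s"
text \<open>Integrating the varied density by parts until only \<open>\<eta>'\<close> remains leaves
  the coefficient \<open>- (f n - h b)' + g \<kappa> b\<close>. Its normal and binormal components
  are \<open>force_n\<close> and \<open>force_b\<close>; its tangential component may be replaced
  freely, as \<open>t . \<eta>' = 0\<close>.\<close>

definition force_n where "force_n s = - d f s - h s * \<tau> s"
definition force_b where "force_b s = - (f s * \<tau> s) + d h s + g s * \<kappa> s"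
definition force_t \<comment> \<open>makes the normal component of the derivative of the internal force vanish\<close>
  where "force_t s = (\<tau> s * force_b s - d force_n s) / \<kappa> s"

definition internal_force :: "real \<Rightarrow> real^3"
  where "internal_force s = force_t s *\<^sub>R tang s + force_n s *\<^sub>R nrml s + force_b s *\<^sub>R bnrm s"

lemma smooth_h: "smooth h"
  unfolding h_def[abs_def] by (intro smooth_intros g \<kappa>_nonzero)

lemma smooth_force_n: "smooth force_n"
  unfolding force_n_def[abs_def] by (intro smooth_intros f smooth_h)

lemma smooth_force_b: "smooth force_b"
  unfolding force_b_def[abs_def] by (intro smooth_intros f g smooth_h)

lemma smooth_force_t: "smooth force_t"
  unfolding force_t_def[abs_def] by (intro smooth_intros smooth_force_n smooth_force_b \<kappa>_nonzero)

lemma smooth_internal_force: "smooth internal_force"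
  unfolding internal_force_def[abs_def]
  by (intro smooth_intros smooth_force_n smooth_force_b smooth_force_t)

lemma d_force_n:
  assumes s: "s \<in> {0..S0}"
  shows "d force_n s = - d (d f) s - (h s * d \<tau> s + d h s * \<tau> s)"
  unfolding force_n_def[abs_def]
  by (subst d_diff[OF _ _ s]) (auto intro!: smooth_intros f smooth_h simp: d_minus[OF smooth_d[OF f] s] d_mult[OF s smooth_h smooth_frame(5)])

lemma d_force_b:
  assumes s: "s \<in> {0..S0}"
  shows "d force_b s = - (f s * d \<tau> s + d f s * \<tau> s) + d (d h) s + d (\<lambda>x. g x * \<kappa> x) s"
proof -
  have "d force_b s = d (\<lambda>x. - (f x * \<tau> x)) s + d (d h) s + d (\<lambda>x. g x * \<kappa> x) s"
    unfolding force_b_def[abs_def]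
    by (subst d_add[OF _ _ s], (intro smooth_intros f g smooth_h)+)+ simp
  also have "d (\<lambda>x. - (f x * \<tau> x)) s = - d (\<lambda>x. f x * \<tau> x) s"
    by (rule d_minus[OF _ s]) (intro smooth_intros f)
  also have "d (\<lambda>x. f x * \<tau> x) s = f s * d \<tau> s + d f s * \<tau> s"
    by (rule d_mult[OF s f smooth_frame(5)])
  finally show ?thesis .
qed

lemma d_g: "s \<in> {0..S0} \<Longrightarrow> d g s = \<kappa> s * h s"
  using \<kappa>_nonzero by (simp add: h_def)

text \<open>In \<open>2 \<kappa> f'\<close> and \<open>2 \<tau> g'\<close> one copy comes from
  differentiating \<open>f \<kappa>\<close> and \<open>g \<tau>\<close>. The other compensates the
  term \<open>\<kappa> force_n\<close>, which contains \<open>- \<kappa> f' - \<tau> g'\<close>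
  because \<open>g' = \<kappa> h\<close>.\<close>

lemma d_force_t:
  assumes s: "s \<in> {0..S0}"
  shows "d force_t s = EL_tangent f g s + \<kappa> s * force_n s"
proof -
  let ?a = "\<lambda>x. (- f x * (\<tau> x)\<^sup>2 - f x * (\<kappa> x)\<^sup>2 + d (d f) x) / \<kappa> x"
  let ?b = "\<lambda>x. (2 * \<tau> x * d h x + h x * d \<tau> x) / \<kappa> x"
  have a: "smooth ?a"
    by (intro smooth_intros f \<kappa>_nonzero)
  have b: "smooth ?b"
    by (intro smooth_intros smooth_h \<kappa>_nonzero)
  have gt: "smooth (\<lambda>x. g x * \<tau> x)" and fk: "smooth (\<lambda>x. f x * \<kappa> x)"
    by (intro smooth_intros f g)+
  \<comment> \<open>The summand \<open>f \<kappa>\<close> is added to balance the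
    \<open>- f \<kappa>^2\<close> inside the first quotient.\<close>
  have "force_t x = ?a x + ?b x + g x * \<tau> x + f x * \<kappa> x" if "x \<in> {0..S0}" for x
    using \<kappa>_nonzero[OF that]
    by (simp add: force_t_def force_b_def d_force_n[OF that] field_simps power2_eq_square)
  then have "d force_t s = d (\<lambda>x. ?a x + ?b x + g x * \<tau> x + f x * \<kappa> x) s"
    by (rule D_on_cong[OF _ s])
  also have "\<dots> = d ?a s + d ?b s + d (\<lambda>x. g x * \<tau> x) s + d (\<lambda>x. f x * \<kappa> x) s"
    using d_add[OF smooth_family_add[OF smooth_family_add[OF a b] gt] fk s]
      d_add[OF smooth_family_add[OF a b] gt s] d_add[OF a b s] by simp
  also have "d (\<lambda>x. g x * \<tau> x) s = g s * d \<tau> s + d g s * \<tau> s"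
    by (rule d_mult[OF s g smooth_frame(5)])
  also have "d (\<lambda>x. f x * \<kappa> x) s = f s * d \<kappa> s + d f s * \<kappa> s"
    by (rule d_mult[OF s f smooth_frame(4)])
  finally show ?thesis
    by (simp add: EL_tangent_def Let_def force_n_def d_g[OF s] flip: h_def) (simp add: algebra_simps)
qed

lemma d_internal_force:
  assumes s: "s \<in> {0..S0}"
  shows "d internal_force s = EL_tangent f g s *\<^sub>R tang s - EL_binormal f g s *\<^sub>R bnrm s"
proof -
  have sm: "smooth (\<lambda>x. force_t x *\<^sub>R tang x)" "smooth (\<lambda>x. force_n x *\<^sub>R nrml x)"
      "smooth (\<lambda>x. force_b x *\<^sub>R bnrm x)"
    by (intro smooth_intros smooth_force_t smooth_force_n smooth_force_b)+
  have "d internal_force s = d (\<lambda>x. force_t x *\<^sub>R tang x) s + d (\<lambda>x. force_n x *\<^sub>R nrml x) s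
      + d (\<lambda>x. force_b x *\<^sub>R bnrm x) s"
    unfolding internal_force_def[abs_def]
    using d_add[OF smooth_family_add[OF sm(1,2)] sm(3) s] d_add[OF sm(1,2) s] by simp
  also have "\<dots> = (force_t s *\<^sub>R (\<kappa> s *\<^sub>R nrml s) + d force_t s *\<^sub>R tang s)
      + (force_n s *\<^sub>R (- \<kappa> s *\<^sub>R tang s + \<tau> s *\<^sub>R bnrm s) + d force_n s *\<^sub>R nrml s)
      + (force_b s *\<^sub>R (- \<tau> s *\<^sub>R nrml s) + d force_b s *\<^sub>R bnrm s)"
    by (simp only: d_scaleR[OF s smooth_force_t smooth_frame(1)]
        d_scaleR[OF s smooth_force_n smooth_frame(2)] d_scaleR[OF s smooth_force_b smooth_frame(3)]
        frenet_tangent[OF s] frenet_normal[OF s] frenet_binormal[OF s])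
  also have "\<dots> = (d force_t s - \<kappa> s * force_n s) *\<^sub>R tang s
      + (force_t s * \<kappa> s + d force_n s - \<tau> s * force_b s) *\<^sub>R nrml s
      + (\<tau> s * force_n s + d force_b s) *\<^sub>R bnrm s"
    by (simp add: algebra_simps)
  also have "force_t s * \<kappa> s + d force_n s - \<tau> s * force_b s = 0"
    using \<kappa>_nonzero[OF s] by (simp add: force_t_def)
  also have "\<tau> s * force_n s + d force_b s = - EL_binormal f g s"
    by (simp add: EL_binormal_def Let_def force_n_def d_force_b[OF s] flip: h_def)
      (simp add: algebra_simps power2_eq_square)
  finally show ?thesis
    by (simp add: d_force_t[OF s])
qed

end

section \<open>The first variation of the energy\<close>

context inextensible_variation
begin

text \<open>On the interval these formulas equal \<open>\<delta>\<kappa>\<close> and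
  \<open>\<delta>\<tau>\<close>, but they refer to no parameter set \<open>T\<close>. The auxiliary
  \<open>twist\<close> is \<open>b . \<nu>\<close>, the infinitesimal rotation of the frame about
  the tangent.\<close>

definition var_\<kappa> :: "real \<Rightarrow> real" where "var_\<kappa> s = nrml s \<bullet> d (d \<eta>) s"
definition twist :: "real \<Rightarrow> real" where "twist s = bnrm s \<bullet> d (d \<eta>) s / \<kappa> s"
definition var_\<tau> :: "real \<Rightarrow> real" where "var_\<tau> s = d twist s + \<kappa> s * (bnrm s \<bullet> d \<eta> s)"

lemma smooth_var_\<kappa>: "smooth var_\<kappa>"
  unfolding var_\<kappa>_def[abs_def] by (intro smooth_intros)

lemma smooth_twist: "smooth twist"
  unfolding twist_def[abs_def] by (intro smooth_intros \<kappa>_nonzero)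

lemma smooth_var_\<tau>: "smooth var_\<tau>"
  unfolding var_\<tau>_def[abs_def] by (intro smooth_intros smooth_twist)

lemma weak_form_eq_strong_form:
  assumes fg: "smooth f" "smooth g" and "vanishes_near_ends \<eta>"
  shows "integral {0..S0} (\<lambda>s. f s * var_\<kappa> s + g s * var_\<tau> s) =
    - integral {0..S0} (\<lambda>s. EL_tangent f g s * (tang s \<bullet> \<eta> s) - EL_binormal f g s * (bnrm s \<bullet> \<eta> s))"
proof -
  interpret stress_resultants S0 r f g
    by unfold_locales (fact fg)+
  \<comment> \<open>\<open>V\<close> is the coefficient of \<open>\<eta>''\<close> after the
    derivative of \<open>twist\<close> has been moved onto \<open>g\<close>, since
    \<open>g' twist = h (b . \<eta>'')\<close>.\<close>
  define V where "V s = f s *\<^sub>R nrml s - h s *\<^sub>R bnrm s" for s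
  \<comment> \<open>the boundary terms of all integrations by parts\<close>
  define Q where "Q s = g s * twist s + V s \<bullet> d \<eta> s + internal_force s \<bullet> \<eta> s" for s
  have V: "smooth V"
    unfolding V_def[abs_def] by (intro smooth_intros f smooth_h)
  have Q_parts: "smooth (\<lambda>s. g s * twist s)" "smooth (\<lambda>s. V s \<bullet> d \<eta> s)" "smooth (\<lambda>s. internal_force s \<bullet> \<eta> s)"
    by (intro smooth_intros g V smooth_twist smooth_internal_force)+
  have "smooth Q"
    unfolding Q_def[abs_def] by (intro smooth_family_add Q_parts)
  moreover have "Q 0 = 0" "Q S0 = 0"
    using vanishes_near_ends_imp[OF assms(3)]
      vanishes_near_ends_imp[OF vanishes_near_ends_d[OF assms(3)]]
      vanishes_near_ends_imp[OF vanishes_near_ends_d[OF vanishes_near_ends_d[OF assms(3)]]]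
    by (simp_all add: Q_def twist_def)
  ultimately have "(d Q has_integral 0) {0..S0}"
    by (rule integral_d_eq_0)
  moreover have "d Q s = (f s * var_\<kappa> s + g s * var_\<tau> s) + d internal_force s \<bullet> \<eta> s"
    if s: "s \<in> {0..S0}" for s
  proof -
    have "d Q s = d (\<lambda>s. g s * twist s) s + d (\<lambda>s. V s \<bullet> d \<eta> s) s + d (\<lambda>s. internal_force s \<bullet> \<eta> s) s"
      unfolding Q_def[abs_def]
      using d_add[OF smooth_family_add[OF Q_parts(1,2)] Q_parts(3) s] d_add[OF Q_parts(1,2) s] by simp
    also have "\<dots> = (g s * d twist s + d g s * twist s) + (V s \<bullet> d (d \<eta>) s + d V s \<bullet> d \<eta> s)
        + (internal_force s \<bullet> d \<eta> s + d internal_force s \<bullet> \<eta> s)"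
      by (simp only: d_mult[OF s g smooth_twist] d_inner[OF s V smooth_d[OF smooth_\<eta>]]
          d_inner[OF s smooth_internal_force smooth_\<eta>])
    also have "d V s = (f s *\<^sub>R (- \<kappa> s *\<^sub>R tang s + \<tau> s *\<^sub>R bnrm s) + d f s *\<^sub>R nrml s)
        - (h s *\<^sub>R (- \<tau> s *\<^sub>R nrml s) + d h s *\<^sub>R bnrm s)"
    proof -
      have "smooth (\<lambda>s. f s *\<^sub>R nrml s)" "smooth (\<lambda>s. h s *\<^sub>R bnrm s)"
        by (intro smooth_intros f smooth_h)+
      from d_diff[OF this s] show ?thesis
        unfolding V_def[abs_def]
        by (simp only: d_scaleR[OF s f smooth_frame(2)] d_scaleR[OF s smooth_h smooth_frame(3)]
            frenet_normal[OF s] frenet_binormal[OF s])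
    qed
    also have "d g s * twist s = h s * (bnrm s \<bullet> d (d \<eta>) s)"
      using \<kappa>_nonzero[OF s] by (simp add: d_g[OF s] twist_def)
    \<comment> \<open>Inextensibility makes \<open>force_t\<close> drop out, which is why it could
      be chosen freely.\<close>
    also have "internal_force s \<bullet> d \<eta> s = force_n s * (nrml s \<bullet> d \<eta> s) + force_b s * (bnrm s \<bullet> d \<eta> s)"
      using inextensible[OF s] by (simp add: internal_force_def tangent_eq[OF s] inner_add_left)
    finally show ?thesis
      using inextensible[OF s]
      by (simp add: var_\<kappa>_def var_\<tau>_def V_def force_n_def force_b_def
          tangent_eq[OF s] inner_add_left inner_diff_left algebra_simps)
  qed
  ultimately have total: "((\<lambda>s. (f s * var_\<kappa> s + g s * var_\<tau> s) + d internal_force s \<bullet> \<eta> s) has_integral 0) {0..S0}"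
    by (rule has_integral_eq[rotated])
  have "(\<lambda>s. f s * var_\<kappa> s + g s * var_\<tau> s) integrable_on {0..S0}"
    by (rule integrable_smooth) (intro smooth_intros f g smooth_var_\<kappa> smooth_var_\<tau>)
  moreover have "(\<lambda>s. d internal_force s \<bullet> \<eta> s) integrable_on {0..S0}"
    by (rule integrable_smooth) (intro smooth_intros smooth_internal_force)
  ultimately have "integral {0..S0} (\<lambda>s. f s * var_\<kappa> s + g s * var_\<tau> s)
      + integral {0..S0} (\<lambda>s. d internal_force s \<bullet> \<eta> s) = 0"
    using integral_unique[OF total] by (simp only: integral_add)
  moreover have "integral {0..S0} (\<lambda>s. d internal_force s \<bullet> \<eta> s) =
      integral {0..S0} (\<lambda>s. EL_tangent f g s * (tang s \<bullet> \<eta> s) - EL_binormal f g s * (bnrm s \<bullet> \<eta> s))"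
    by (rule integral_cong) (simp add: d_internal_force inner_diff_left)
  ultimately show ?thesis by simp
qed

text \<open>Differentiation under the integral combined with the chain rule for densities. The speed
  factor adds nothing, being 1 and stationary at \<open>t = 0\<close>.\<close>

lemma energy_derivative:
  assumes V: "finite V" "depends_only_on V \<epsilon>" and \<epsilon>: "smooth_density_on U \<epsilon>"
    and jet_U: "\<And>s. s \<in> {0..S0} \<Longrightarrow> jet {0..S0} r s \<in> U"
  shows "((\<lambda>t. energy \<epsilon> S0 (\<gamma> t)) has_real_derivative
    integral {0..S0} (\<lambda>s. \<Sum>v\<in>V. partial v \<epsilon> (jet {0..S0} r s) *
      (case v of Curv i \<Rightarrow> (d ^^ i) var_\<kappa> s | Tors i \<Rightarrow> (d ^^ i) var_\<tau> s | Arclen \<Rightarrow> 0))) (at 0)"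
proof -
  obtain T0 where T0: "0 \<in> T0" "regular_family T0 S0 \<gamma>"
    by (rule regular_near_0)
  interpret big: regular_family T0 S0 \<gamma> by fact
  \<comment> \<open>The parameter set is shrunk a second time: the jets depend continuously on
    \<open>(t, s)\<close> in the product topology, so for small \<open>t\<close> they all remain in
    the open set \<open>U\<close>.\<close>
  have "continuous_on (T0 \<times> {0..S0}) (\<lambda>x v. jet {0..S0} (\<gamma> (fst x)) (snd x) v)"
    by (intro continuous_on_coordinatewise_then_product smooth_family_continuous big.smooth_family_jet)
  moreover have "open U"
    using \<epsilon> by (simp add: smooth_density_on_def)
  ultimately obtain T where T: "open T" "0 \<in> T" "T \<subseteq> T0"
    "\<And>t s. t \<in> T \<Longrightarrow> s \<in> {0..S0} \<Longrightarrow> (\<lambda>v. jet {0..S0} (\<gamma> (fst (t, s))) (snd (t, s)) v) \<in> U"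
    by (rule continuous_on_near_slice[of _ _ _ 0, OF _ big.T T0(1) compact_Icc]) (auto simp: jet_U)
  interpret regular_variation S0 r \<eta> T
    by unfold_locales (use S0 T big.speed big.curvature smooth_family_\<gamma> in auto)
  let ?\<Phi> = "\<lambda>t s. \<epsilon> (jet {0..S0} (\<gamma> t) s) * speed {0..S0} (\<gamma> t) s"
  let ?\<delta>v = "\<lambda>v s. case v of Curv i \<Rightarrow> (d ^^ i) \<delta>\<kappa> s | Tors i \<Rightarrow> (d ^^ i) \<delta>\<tau> s | Arclen \<Rightarrow> 0"
  have \<Phi>: "smooth_family T {0..S0} ?\<Phi>"
    using T(4) by (intro smooth_family_mult perturbed.smooth_family_speed
        smooth_family_density[OF \<epsilon> V, of _ _ "\<lambda>v t s. jet {0..S0} (\<gamma> t) s v"]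
        perturbed.smooth_family_jet) auto
  have "parameter_D ?\<Phi> 0 s = (\<Sum>v\<in>V. partial v \<epsilon> (jet {0..S0} r s) * ?\<delta>v v s)"
    if s: "s \<in> {0..S0}" for s
  proof (rule parameter_D_eq)
    have "((\<lambda>t. \<epsilon> (jet {0..S0} (\<gamma> t) s)) has_real_derivative
        (\<Sum>v\<in>V. partial v \<epsilon> (jet {0..S0} (\<gamma> 0) s) * ?\<delta>v v s)) (at 0)"
    proof (rule density_chain_rule[OF \<epsilon> V])
      show "((\<lambda>t. jet {0..S0} (\<gamma> t) s v) has_real_derivative ?\<delta>v v s) (at 0)" for v
        using smooth_family_has_parameter_D[OF perturbed.smooth_family_jet zero s, of v]
        unfolding variation_jet[OF s] has_real_derivative_iff_has_vector_derivative .
    qed (use jet_U[OF s] in simp)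
    from DERIV_mult[OF this variation_speed[OF s]]
    show "((\<lambda>t. ?\<Phi> t s) has_vector_derivative (\<Sum>v\<in>V. partial v \<epsilon> (jet {0..S0} r s) * ?\<delta>v v s)) (at 0)"
      by (simp add: speed_eq_1[OF s] has_real_derivative_iff_has_vector_derivative)
  qed
  moreover have "?\<delta>v v s = (case v of Curv i \<Rightarrow> (d ^^ i) var_\<kappa> s | Tors i \<Rightarrow> (d ^^ i) var_\<tau> s | Arclen \<Rightarrow> 0)"
    if "s \<in> {0..S0}" for v s
  proof -
    have funpow: "(d ^^ i) u s = (d ^^ i) u' s" if "\<And>x. x \<in> {0..S0} \<Longrightarrow> u x = u' x" "s \<in> {0..S0}"
      for i s and u u' :: "real \<Rightarrow> real"
      using that(2) by (induction i arbitrary: s) (auto intro!: that(1) D_on_cong)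
    have "\<delta>\<kappa> x = var_\<kappa> x" "\<delta>\<tau> x = var_\<tau> x" if "x \<in> {0..S0}" for x
      using variation_curvature[OF that] variation_torsion[OF that]
      by (simp_all add: var_\<kappa>_def var_\<tau>_def twist_def[abs_def])
    then show ?thesis
      using funpow[OF _ that, of \<delta>\<kappa> var_\<kappa>] funpow[OF _ that, of \<delta>\<tau> var_\<tau>] by (simp split: jet_coord.split)
  qed
  ultimately have "integral {0..S0} (parameter_D ?\<Phi> 0) =
      integral {0..S0} (\<lambda>s. \<Sum>v\<in>V. partial v \<epsilon> (jet {0..S0} r s) *
      (case v of Curv i \<Rightarrow> (d ^^ i) var_\<kappa> s | Tors i \<Rightarrow> (d ^^ i) var_\<tau> s | Arclen \<Rightarrow> 0))"
    by (intro integral_cong) simp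
  moreover have "((\<lambda>t. integral {0..S0} (?\<Phi> t)) has_vector_derivative integral {0..S0} (parameter_D ?\<Phi> 0)) (at 0)"
    using leibniz_smooth_family[OF \<Phi> perturbed.T zero, of S0] S0 by simp
  ultimately show ?thesis
    by (simp add: energy_def has_real_derivative_iff_has_vector_derivative)
qed

end

section \<open>Stationarity of the crease energy and the Euler-Lagrange equations\<close>

locale crease_energy = unit_speed_crease +
  fixes N :: nat and \<epsilon> :: "(jet_coord \<Rightarrow> real) \<Rightarrow> real" and U :: "(jet_coord \<Rightarrow> real) set"
  assumes \<epsilon>_args: "depends_only_on (jet_coords N) \<epsilon>"
    and \<epsilon>_smooth: "smooth_density_on U \<epsilon>"
    and jet_in_U: "\<And>s. s \<in> {0..S0} \<Longrightarrow> jet {0..S0} r s \<in> U"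
begin

definition f where "f s = (\<Sum>i\<le>2 * N. (- 1) ^ i * (d ^^ i) (\<lambda>x. partial (Curv i) \<epsilon> (jet {0..S0} r x)) s)"
definition g where "g s = (\<Sum>i\<le>2 * N - 1. (- 1) ^ i * (d ^^ i) (\<lambda>x. partial (Tors i) \<epsilon> (jet {0..S0} r x)) s)"

lemma finite_jet_coords: "finite (jet_coords N)"
  by (simp add: jet_coords_def)

lemma smooth_partial: "smooth (\<lambda>x. partial v \<epsilon> (jet {0..S0} r x))"
  using smooth_family_density[OF smooth_density_on_partial[OF \<epsilon>_smooth] finite_jet_coords
      depends_only_on_partial[OF \<epsilon>_args] static.smooth_family_jet jet_in_U] by simp

lemma smooth_term: "smooth (\<lambda>s. (- 1) ^ i * (d ^^ i) (\<lambda>x. partial v \<epsilon> (jet {0..S0} r x)) s)"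
  by (intro smooth_family_mult smooth_family_const smooth_d_funpow smooth_partial)

lemma smooth_f: "smooth f"
  unfolding f_def[abs_def] by (intro smooth_family_sum smooth_term) simp

lemma smooth_g: "smooth g"
  unfolding g_def[abs_def] by (intro smooth_family_sum smooth_term) simp

lemma sum_jet_coords:
  "(\<Sum>v\<in>jet_coords N. F v) = (\<Sum>i\<le>2 * N. F (Curv i)) + (\<Sum>i\<le>2 * N - 1. F (Tors i)) + F Arclen"
  for F :: "jet_coord \<Rightarrow> real"
proof -
  have "(\<Sum>v\<in>jet_coords N. F v) = (\<Sum>v\<in>Curv ` {..2 * N} \<union> Tors ` {..2 * N - 1}. F v) + F Arclen"
    unfolding jet_coords_def by (subst sum.union_disjoint) auto
  also have "(\<Sum>v\<in>Curv ` {..2 * N} \<union> Tors ` {..2 * N - 1}. F v) =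
      (\<Sum>v\<in>Curv ` {..2 * N}. F v) + (\<Sum>v\<in>Tors ` {..2 * N - 1}. F v)"
    by (rule sum.union_disjoint) auto
  finally show ?thesis
    by (simp add: sum.reindex inj_on_def)
qed

lemma first_variation:
  assumes "admissible S0 r \<eta>"
  shows "((\<lambda>t. energy \<epsilon> S0 (\<lambda>s. r s + t *\<^sub>R \<eta> s)) has_real_derivative
    - integral {0..S0} (\<lambda>s. EL_tangent f g s * (tang s \<bullet> \<eta> s) - EL_binormal f g s * (bnrm s \<bullet> \<eta> s))) (at 0)"
proof -
  interpret inextensible_variation S0 r \<eta>
    using assms by unfold_locales (auto simp: admissible_def)
  have \<eta>_ends: "vanishes_near_ends \<eta>"
    using assms by (auto simp: admissible_def vanishes_near_ends_def)
  note d\<eta>_ends = vanishes_near_ends_d[OF \<eta>_ends]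
  note dd\<eta>_ends = vanishes_near_ends_d[OF d\<eta>_ends]
  have twist_ends: "vanishes_near_ends twist"
    by (rule vanishes_near_ends_mono[OF dd\<eta>_ends]) (simp add: twist_def)
  have \<kappa>_ends: "vanishes_near_ends var_\<kappa>"
    by (rule vanishes_near_ends_mono[OF dd\<eta>_ends]) (simp add: var_\<kappa>_def)
  have "vanishes_near_ends (\<lambda>s. \<kappa> s * (bnrm s \<bullet> d \<eta> s))"
    by (rule vanishes_near_ends_mono[OF d\<eta>_ends]) simp
  from vanishes_near_ends_add[OF vanishes_near_ends_d[OF twist_ends] this]
  have \<tau>_ends: "vanishes_near_ends var_\<tau>"
    by (simp add: var_\<tau>_def[abs_def])
  \<comment> \<open>Moving all \<open>i\<close> derivatives off the variation in slot
    \<open>c i\<close> produces the alternating sums defining \<open>f\<close> and \<open>g\<close>;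
    leaving \<open>c\<close> free covers \<open>Curv\<close> and \<open>Tors\<close>
    together.\<close>
  have parts: "integral {0..S0} (\<lambda>s. \<Sum>i\<le>n. partial (c i) \<epsilon> (jet {0..S0} r s) * (d ^^ i) u s) =
      integral {0..S0} (\<lambda>s. (\<Sum>i\<le>n. (- 1) ^ i * (d ^^ i) (\<lambda>x. partial (c i) \<epsilon> (jet {0..S0} r x)) s) * u s)"
    if u: "smooth u" and "vanishes_near_ends u" for n c u
  proof -
    have ends: "(d ^^ j) u 0 = 0" "(d ^^ j) u S0 = 0" for j
      using vanishes_near_ends_imp[OF vanishes_near_ends_funpow[OF that(2), of j]] by auto
    have "integral {0..S0} (\<lambda>s. \<Sum>i\<le>n. partial (c i) \<epsilon> (jet {0..S0} r s) * (d ^^ i) u s) =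
        (\<Sum>i\<le>n. integral {0..S0} (\<lambda>s. partial (c i) \<epsilon> (jet {0..S0} r s) * (d ^^ i) u s))"
      by (intro integral_sum integrable_smooth smooth_family_mult smooth_partial smooth_d_funpow u) simp
    also have "\<dots> = (\<Sum>i\<le>n. integral {0..S0} (\<lambda>s. (- 1) ^ i * (d ^^ i) (\<lambda>x. partial (c i) \<epsilon> (jet {0..S0} r x)) s * u s))"
      by (intro sum.cong refl integral_by_parts_funpow smooth_partial u ends)
    also have "\<dots> = integral {0..S0} (\<lambda>s. \<Sum>i\<le>n. (- 1) ^ i * (d ^^ i) (\<lambda>x. partial (c i) \<epsilon> (jet {0..S0} r x)) s * u s)"
      by (intro integral_sum[symmetric] integrable_smooth smooth_family_mult[OF smooth_term u]) simp
    finally show ?thesis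
      by (simp add: sum_distrib_right)
  qed
  have curv_parts: "integral {0..S0} (\<lambda>s. \<Sum>i\<le>2 * N. partial (Curv i) \<epsilon> (jet {0..S0} r s) * (d ^^ i) var_\<kappa> s)
      = integral {0..S0} (\<lambda>s. f s * var_\<kappa> s)"
    unfolding f_def by (rule parts[OF smooth_var_\<kappa> \<kappa>_ends])
  have tors_parts: "integral {0..S0} (\<lambda>s. \<Sum>i\<le>2 * N - 1. partial (Tors i) \<epsilon> (jet {0..S0} r s) * (d ^^ i) var_\<tau> s)
      = integral {0..S0} (\<lambda>s. g s * var_\<tau> s)"
    unfolding g_def by (rule parts[OF smooth_var_\<tau> \<tau>_ends])
  have int: "(\<lambda>s. \<Sum>i\<le>n. partial (c i) \<epsilon> (jet {0..S0} r s) * (d ^^ i) u s) integrable_on {0..S0}"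
    if u: "smooth u" for n c u
    by (intro integrable_smooth smooth_family_sum smooth_family_mult smooth_partial smooth_d_funpow u) simp
  have "integral {0..S0} (\<lambda>s. \<Sum>v\<in>jet_coords N. partial v \<epsilon> (jet {0..S0} r s) *
      (case v of Curv i \<Rightarrow> (d ^^ i) var_\<kappa> s | Tors i \<Rightarrow> (d ^^ i) var_\<tau> s | Arclen \<Rightarrow> 0))
    = integral {0..S0} (\<lambda>s. (\<Sum>i\<le>2 * N. partial (Curv i) \<epsilon> (jet {0..S0} r s) * (d ^^ i) var_\<kappa> s)
      + (\<Sum>i\<le>2 * N - 1. partial (Tors i) \<epsilon> (jet {0..S0} r s) * (d ^^ i) var_\<tau> s))"
    by (simp add: sum_jet_coords)
  also have "\<dots> = integral {0..S0} (\<lambda>s. f s * var_\<kappa> s) + integral {0..S0} (\<lambda>s. g s * var_\<tau> s)"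
    by (simp only: integral_add int smooth_var_\<kappa> smooth_var_\<tau> curv_parts tors_parts)
  also have "\<dots> = integral {0..S0} (\<lambda>s. f s * var_\<kappa> s + g s * var_\<tau> s)"
    by (intro integral_add[symmetric] integrable_smooth smooth_family_mult smooth_f smooth_g
        smooth_var_\<kappa> smooth_var_\<tau>)
  also have "\<dots> = - integral {0..S0} (\<lambda>s. EL_tangent f g s * (tang s \<bullet> \<eta> s) - EL_binormal f g s * (bnrm s \<bullet> \<eta> s))"
    by (rule weak_form_eq_strong_form[OF smooth_f smooth_g \<eta>_ends])
  finally show ?thesis
    using energy_derivative[OF finite_jet_coords \<epsilon>_args \<epsilon>_smooth jet_in_U] by simp
qed

lemma smooth_EL_tangent: "smooth (EL_tangent f g)"
  unfolding EL_tangent_def[abs_def] Let_def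
  by (intro smooth_intros smooth_f smooth_g \<kappa>_nonzero S0 open_UNIV)

lemma smooth_EL_binormal: "smooth (EL_binormal f g)"
  unfolding EL_binormal_def[abs_def] Let_def
  by (intro smooth_intros smooth_f smooth_g \<kappa>_nonzero S0 open_UNIV)

lemmas smooth_EL = smooth_EL_tangent smooth_EL_binormal

lemma EL_eq_0_if_stationary:
  assumes "stationary \<epsilon> S0 r" and s0: "s0 \<in> {0<..<S0}"
  shows "EL_tangent f g s0 = 0" "EL_binormal f g s0 = 0"
proof -
  \<comment> \<open>Half the distance from \<open>s0\<close> to the nearer end: \<open>s0\<close>
    lies strictly between \<open>\<delta>\<close> and \<open>S0 - \<delta>\<close>.\<close>
  define \<delta> where "\<delta> = min s0 (S0 - s0) / 2"
  have \<delta>: "\<delta> > 0" "\<delta> < s0" "\<delta> < S0 - s0"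
    using s0 by (auto simp: \<delta>_def min_def field_simps)
  \<comment> \<open>A flat function rising at \<open>\<delta>\<close> times a reflected one ending
    at \<open>S0 - \<delta>\<close>: the product is positive exactly between these points.\<close>
  define \<phi> where "\<phi> s = flat_exp 1 (1 * s + (- \<delta>)) * flat_exp 1 (- 1 * s + (S0 - \<delta>))" for s
  have \<phi>: "smooth \<phi>"
    unfolding \<phi>_def[abs_def] by (intro smooth_family_mult smooth_family_flat_exp)
  have \<phi>_nonneg: "\<phi> s \<ge> 0" and \<phi>_0: "s < \<delta> \<or> S0 - \<delta> < s \<Longrightarrow> \<phi> s = 0" for s
    by (auto simp: \<phi>_def flat_exp_def)
  have \<phi>_pos: "\<phi> s0 > 0"
    using \<delta> by (simp add: \<phi>_def flat_exp_def)
  define a where "a s = \<phi> s * EL_tangent f g s" for s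
  \<comment> \<open>the normal component is forced by \<open>\<eta>' \<bullet> t = a' - \<kappa> (\<eta> \<bullet> n) = 0\<close>\<close>
  define \<eta> where "\<eta> s = a s *\<^sub>R tang s + (d a s / \<kappa> s) *\<^sub>R nrml s
      - (\<phi> s * EL_binormal f g s) *\<^sub>R bnrm s" for s
  have a: "smooth a"
    unfolding a_def[abs_def] by (intro smooth_intros \<phi> smooth_EL)
  have \<eta>: "smooth \<eta>"
    unfolding \<eta>_def[abs_def] by (intro smooth_intros \<phi> smooth_EL a \<kappa>_nonzero)
  have t\<eta>: "tang s \<bullet> \<eta> s = a s" and n\<eta>: "nrml s \<bullet> \<eta> s = d a s / \<kappa> s"
    and b\<eta>: "bnrm s \<bullet> \<eta> s = - \<phi> s * EL_binormal f g s" if "s \<in> {0..S0}" for s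
    by (simp_all add: \<eta>_def inner_add_right inner_diff_right orthonormal[OF that])
  have "admissible S0 r \<eta>"
    unfolding admissible_def
  proof (intro conjI ballI)
    show "smooth_curve_on {0..S0} \<eta>"
      using \<eta> S0 by (simp add: smooth_curve_on_iff)
    show "d r s \<bullet> d \<eta> s = 0" if s: "s \<in> {0..S0}" for s
    proof -
      have "d a s = d (\<lambda>x. tang x \<bullet> \<eta> x) s"
        by (rule D_on_cong[OF _ s]) (simp add: t\<eta>)
      also have "\<dots> = tang s \<bullet> d \<eta> s + d tang s \<bullet> \<eta> s"
        by (rule d_inner[OF s smooth_frame(1) \<eta>])
      also have "d tang s \<bullet> \<eta> s = d a s"
        using \<kappa>_nonzero[OF s] by (simp add: frenet_tangent[OF s] n\<eta>[OF s])
      finally show ?thesis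
        by (simp add: tangent_eq[OF s])
    qed
    have "d a s = 0" if "s \<in> {0..S0}" "s < \<delta> \<or> S0 - \<delta> < s" for s
      by (rule d_eq_0_near[of "{..<\<delta>} \<union> {S0 - \<delta><..}"]) (use that \<phi>_0 in \<open>auto simp: a_def\<close>)
    then show "\<exists>\<delta>>0. \<forall>s\<in>{0..S0}. s < \<delta> \<or> S0 - \<delta> < s \<longrightarrow> \<eta> s = 0"
      using \<delta>(1) \<phi>_0 by (auto simp: \<eta>_def a_def intro!: exI[of _ \<delta>])
  qed
  with assms(1) have "((\<lambda>t. energy \<epsilon> S0 (\<lambda>s. r s + t *\<^sub>R \<eta> s)) has_real_derivative 0) (at 0)"
    unfolding stationary_def by blast
  from DERIV_unique[OF this first_variation[OF \<open>admissible S0 r \<eta>\<close>]]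
  have "integral {0..S0} (\<lambda>s. EL_tangent f g s * (tang s \<bullet> \<eta> s) - EL_binormal f g s * (bnrm s \<bullet> \<eta> s)) = 0"
    by simp
  \<comment> \<open>The minus sign in the binormal component of \<open>\<eta>\<close> turns the
    difference into a sum of squares.\<close>
  also have "integral {0..S0} (\<lambda>s. EL_tangent f g s * (tang s \<bullet> \<eta> s) - EL_binormal f g s * (bnrm s \<bullet> \<eta> s))
      = integral {0..S0} (\<lambda>s. \<phi> s * ((EL_tangent f g s)\<^sup>2 + (EL_binormal f g s)\<^sup>2))"
    by (rule integral_cong) (simp add: t\<eta> b\<eta> a_def power2_eq_square algebra_simps)
  finally have "integral {0..S0} (\<lambda>s. \<phi> s * ((EL_tangent f g s)\<^sup>2 + (EL_binormal f g s)\<^sup>2)) = 0" .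
  moreover have "continuous_on {0..S0} (\<lambda>s. \<phi> s * ((EL_tangent f g s)\<^sup>2 + (EL_binormal f g s)\<^sup>2))"
    by (rule continuous_smooth) (intro smooth_intros \<phi> smooth_EL)
  ultimately have "\<forall>s\<in>{0..S0}. \<phi> s * ((EL_tangent f g s)\<^sup>2 + (EL_binormal f g s)\<^sup>2) = 0"
    using integral_eq_0_iff[of 0 S0 "\<lambda>s. \<phi> s * ((EL_tangent f g s)\<^sup>2 + (EL_binormal f g s)\<^sup>2)"] S0 \<phi>_nonneg
    by auto
  then have "(EL_tangent f g s0)\<^sup>2 + (EL_binormal f g s0)\<^sup>2 = 0"
    using s0 \<phi>_pos by force
  then show "EL_tangent f g s0 = 0" "EL_binormal f g s0 = 0"
    by (simp_all add: sum_power2_eq_zero_iff)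
qed

lemma stationary_if_EL_eq_0:
  assumes "\<And>s. s \<in> {0<..<S0} \<Longrightarrow> EL_tangent f g s = 0 \<and> EL_binormal f g s = 0"
  shows "stationary \<epsilon> S0 r"
  unfolding stationary_def
proof (intro allI impI)
  fix \<eta> assume \<eta>: "admissible S0 r \<eta>"
  then have "vanishes_near_ends \<eta>"
    by (auto simp: admissible_def vanishes_near_ends_def)
  then have "\<eta> 0 = 0" "\<eta> S0 = 0"
    by (auto dest: vanishes_near_ends_imp)
  then have "EL_tangent f g s * (tang s \<bullet> \<eta> s) - EL_binormal f g s * (bnrm s \<bullet> \<eta> s) = 0"
    if "s \<in> {0..S0}" for s
    \<comment> \<open>The equations are given only in the open interval; at its ends the integrand
      vanishes through \<open>\<eta>\<close>.\<close>
    using assms[of s] that by (cases "s = 0 \<or> s = S0") auto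
  then have "integral {0..S0} (\<lambda>s. EL_tangent f g s * (tang s \<bullet> \<eta> s) - EL_binormal f g s * (bnrm s \<bullet> \<eta> s))
      = integral {0..S0} (\<lambda>s. 0)"
    by (rule integral_cong)
  with first_variation[OF \<eta>]
  show "((\<lambda>t. energy \<epsilon> S0 (\<lambda>s. r s + t *\<^sub>R \<eta> s)) has_real_derivative 0) (at 0)"
    by simp
qed

end

theorem mainTheorem2:
  fixes N :: nat and S0 :: real
    and r :: "real \<Rightarrow> real^3"
    and \<epsilon> :: "(jet_coord \<Rightarrow> real) \<Rightarrow> real"
    and U :: "(jet_coord \<Rightarrow> real) set"
    and d :: "(real \<Rightarrow> real) \<Rightarrow> real \<Rightarrow> real"
    and \<kappa> \<tau> f g h :: "real \<Rightarrow> real"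
  defines "d \<equiv> D_on {0..S0}"
    and "\<kappa> \<equiv> curvature {0..S0} r"
    and "\<tau> \<equiv> torsion {0..S0} r"
    and "f \<equiv> \<lambda>s. \<Sum>i\<le>2 * N. (- 1) ^ i * (d ^^ i) (\<lambda>x. partial (Curv i) \<epsilon> (jet {0..S0} r x)) s"
    and "g \<equiv> \<lambda>s. \<Sum>i\<le>2 * N - 1. (- 1) ^ i * (d ^^ i) (\<lambda>x. partial (Tors i) \<epsilon> (jet {0..S0} r x)) s"
    and "h \<equiv> \<lambda>s. d g s / \<kappa> s"
  assumes "1 \<le> N" and "0 < S0"
    and r_smooth: "smooth_curve_on {0..S0} r"
    and r_arclength: "\<And>s. s \<in> {0..S0} \<Longrightarrow> norm (D_on {0..S0} r s) = 1"
    and \<kappa>_pos: "\<And>s. s \<in> {0..S0} \<Longrightarrow> 0 < \<kappa> s"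
    and \<epsilon>_args: "depends_only_on (jet_coords N) \<epsilon>"
    and \<epsilon>_smooth: "smooth_density_on U \<epsilon>"
    and jet_in_U: "\<And>s. s \<in> {0..S0} \<Longrightarrow> jet {0..S0} r s \<in> U"
  shows "stationary \<epsilon> S0 r \<longleftrightarrow>
    (\<forall>s\<in>{0<..<S0}.
      f s * d \<kappa> s + 2 * \<kappa> s * d f s
        + d (\<lambda>x. (- f x * (\<tau> x)\<^sup>2 - f x * (\<kappa> x)\<^sup>2 + d (d f) x) / \<kappa> x) s
        + g s * d \<tau> s + 2 * \<tau> s * d g s
        + d (\<lambda>x. (2 * \<tau> x * d h x + h x * d \<tau> x) / \<kappa> x) s = 0 \<and>
      h s * (\<tau> s)\<^sup>2 - d (\<lambda>x. g x * \<kappa> x) s - d (d h) s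
        + f s * d \<tau> s + 2 * \<tau> s * d f s = 0)"
proof -
  interpret E: crease_energy S0 r N \<epsilon> U
    using assms unfolding \<kappa>_def by unfold_locales
  have f: "f = E.f" and g: "g = E.g"
    by (auto simp: f_def g_def E.f_def E.g_def d_def)
  have "stationary \<epsilon> S0 r \<longleftrightarrow> (\<forall>s\<in>{0<..<S0}. E.EL_tangent f g s = 0 \<and> E.EL_binormal f g s = 0)"
    unfolding f g using E.EL_eq_0_if_stationary E.stationary_if_EL_eq_0 by blast
  then show ?thesis
    unfolding E.EL_tangent_def E.EL_binormal_def Let_def h_def d_def \<kappa>_def \<tau>_def .
qed

end
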